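(* Let $m>1$, $0\le u_0\in L^1(\mathbb{R}^N)$, let $-\mathfrak{L}$ be an operator as in the context for which the Green function assumption holds with $A=I-\mathfrak{L}$, and let $u$ be a weak dual solution of $\partial_t u+(-\mathfrak{L})[u^m]=0$ with initial data $u_0$. Suppose that for some $p\in(1,\infty)$ there is a constant $C_p>0$ with $$\|\mathbb{G}_{I-\mathfrak{L}}^{x_0}\|_{L^p(\mathbb{R}^N)}=\|\mathbb{G}_{I-\mathfrak{L}}^{0}\|_{L^p(\mathbb{R}^N)}\le C_p<\infty .$$ Put $q:=\frac{p}{p-1}=\big(1-\frac1p\big)^{-1}$ and $C(m):=2(1+m)^{\frac{m}{m-1}}$. Then $$\|u(\cdot,t)\|_{L^\infty(\mathbb{R}^N)}\le\begin{cases}2(m-1)^{-\frac1{m-1}}t^{-\frac1{m-1}}&\text{for a.e. }0<t\le t_0,\\ 2\,C(m)^{q}\,C_p^{q}\,\|u_0\|_{L^1(\mathbb{R}^N)}&\text{for a.e. }t>t_0,\end{cases}$$ where $$t_0:=\frac1{m-1}\big(C(m)^{q}C_p^{q}\big)^{-(m-1)}\|u_0\|_{L^1(\mathbb{R}^N)}^{-(m-1)}.$$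
   Context: Throughout $N\ge 3$. Operator. $-\mathfrak{L}$ is a linear, symmetric, nonnegative operator which is densely defined, $\mathfrak m$-accretive and Dirichlet in $L^1(\mathbb{R}^N)$: writing $A=-\mathfrak{L}$ with domain $D(A)\subset L^1(\mathbb{R}^N)$, $D(A)$ is dense in $L^1$; $\|u\|_{L^1}\le\|u+\lambda A[u]\|_{L^1}$ for all $u\in D(A)$, $\lambda>0$; the range of $I+\lambda A$ is $L^1(\mathbb{R}^N)$ for all $\lambda>0$; and if $f\in L^1$, $a\le f\le b$ a.e. ($a,b\in\mathbb{R}$), then $a\le(I+\lambda A)^{-1}f\le b$ a.e. Green function assumption for an operator $A$: there is a function $\mathbb{G}_A^{x_0}\in L^1_{\rm loc}(\mathbb{R}^N)$ (for each $x_0$) with $0\le\mathbb{G}_A^{x_0}=\mathbb{G}_A^0(\cdot-x_0)=\mathbb{G}_A^0(x_0-\cdot)$ a.e. and $A[\mathbb{G}_A^{x_0}]=\delta_{x_0}$ in $\mathcal D'(\mathbb{R}^N)$. Then $A^{-1}[f](y):=\int_{\mathbb{R}^N}\mathbb{G}_A^0(x-y)f(x)\,dx$ whenever the integral converges. One has $\|\mathbb{G}^0_{I-\mathfrak{L}}\|_{L^1(\mathbb{R}^N)}\le1$. Weak dual solution (resolvent form, used because the equation is equivalent to $\partial_tu+(I-\mathfrak{L})[u^m]=u^m$) in $\mathbb{R}^N\times(0,T)$ with $u(\cdot,0)=u_0$: a nonnegative measurable $u$ such that (i) $u\in C([0,T];L^1(\mathbb{R}^N))$ and $u^m\in L^1((0,T);L^1_{\rm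 loc}(\mathbb{R}^N))$; (ii) for a.e. $0<\tau_1\le\tau_2\le T$ and all $\psi\in C^1_{\rm c}([\tau_1,\tau_2];L^\infty_{\rm c}(\mathbb{R}^N))$ ($L_{\rm c}^\infty$: bounded functions with compact support), the integrals being well defined, $$\int_{\tau_1}^{\tau_2}\!\!\int_{\mathbb{R}^N}\big((I-\mathfrak{L})^{-1}[u]\partial_t\psi-u^m\psi+u^m(I-\mathfrak{L})^{-1}[\psi]\big)dx\,dt=\int_{\mathbb{R}^N}(I-\mathfrak{L})^{-1}[u(\cdot,\tau_2)]\psi(\cdot,\tau_2)dx-\int_{\mathbb{R}^N}(I-\mathfrak{L})^{-1}[u(\cdot,\tau_1)]\psi(\cdot,\tau_1)dx;$$ (iii) $u(\cdot,0)=u_0$ a.e. Here $u$ is a weak dual solution for every $T>0$. Standing assumption: the comparison principle ($u_0\le v_0$ a.e. implies $u\le v$ a.e.) and $L^p$-decay ($\|u(\cdot,\tau_2)\|_{L^r}\le\|u(\cdot,\tau_1)\|_{L^r}$ for $r\in[1,\infty]$ and a.e. $0\le\tau_1\le\tau_2$) hold for solutions of the equation. *)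

theory Defs
  imports "HOL-Analysis.Analysis" "HOL-Probability.Essential_Supremum"
begin

text \<open>Elements of \<open>L\<^sup>r\<close> are represented by Borel functions; every Lebesgue measurable function
  agrees a.e. with one of these. Equalities and inequalities between them are stated a.e.\<close>

section \<open>Function spaces\<close>

text \<open>The exponent ranges over \<open>[1,\<infinity>]\<close> and the norm takes values in \<open>[0,\<infinity>]\<close>.\<close>

definition Lnorm :: "ennreal \<Rightarrow> ('a::euclidean_space \<Rightarrow> real) \<Rightarrow> ennreal" where
  "Lnorm r f =
    (if r = \<infinity> then esssup lborel (\<lambda>x. ennreal \<bar>f x\<bar>)
     else let I = (\<integral>\<^sup>+x. ennreal (\<bar>f x\<bar> powr enn2real r) \<partial>lborel)
          in if I = \<infinity> then \<infinity> else ennreal (enn2real I powr (1 / enn2real r)))"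

definition locally_integrable :: "('a::euclidean_space \<Rightarrow> real) \<Rightarrow> bool" where
  "locally_integrable f \<longleftrightarrow>
    f \<in> borel_measurable borel \<and> (\<forall>K. compact K \<longrightarrow> set_integrable lborel K f)"

text \<open>\<open>k\<close> times continuously differentiable, through iterated directional derivatives.\<close>

fun Ck :: "nat \<Rightarrow> ('a::euclidean_space \<Rightarrow> real) \<Rightarrow> bool" where
  "Ck 0 f \<longleftrightarrow> continuous_on UNIV f"
| "Ck (Suc k) f \<longleftrightarrow>
    (\<forall>x. f differentiable (at x)) \<and> (\<forall>v. Ck k (\<lambda>x. frechet_derivative f (at x) v))"

definition test_function :: "('a::euclidean_space \<Rightarrow> real) \<Rightarrow> bool" where
  "test_function \<psi> \<longleftrightarrow> (\<forall>k. Ck k \<psi>) \<and> compact (closure {x. \<psi> x \<noteq> 0})"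

section \<open>Operators in \<open>L\<^sup>1\<close>\<close>

text \<open>An operator is a domain \<open>D\<close> together with a map \<open>A\<close>, both compatible with a.e. equality;
  values of \<open>A\<close> outside \<open>D\<close> are irrelevant.\<close>

definition L1_operator ::
  "('a::euclidean_space \<Rightarrow> real) set \<Rightarrow> (('a \<Rightarrow> real) \<Rightarrow> 'a \<Rightarrow> real) \<Rightarrow> bool" where
  "L1_operator D A \<longleftrightarrow>
    (\<forall>f\<in>D. integrable lborel f \<and> integrable lborel (A f)) \<and>
    (\<forall>f\<in>D. \<forall>g\<in>borel_measurable borel. (AE x in lborel. f x = g x) \<longrightarrow>
       g \<in> D \<and> (AE x in lborel. A f x = A g x))"

definition linear_operator ::
  "('a::euclidean_space \<Rightarrow> real) set \<Rightarrow> (('a \<Rightarrow> real) \<Rightarrow> 'a \<Rightarrow> real) \<Rightarrow> bool" where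
  "linear_operator D A \<longleftrightarrow>
    (\<forall>f\<in>D. \<forall>g\<in>D. \<forall>a b. (\<lambda>x. a * f x + b * g x) \<in> D \<and>
       (AE x in lborel. A (\<lambda>x. a * f x + b * g x) x = a * A f x + b * A g x))"

text \<open>Symmetry and nonnegativity refer to the pairing of \<open>L\<^sup>1\<close> with \<open>L\<^sup>\<infinity>\<close>: all integrals below
  converge, because \<open>A\<close> takes values in \<open>L\<^sup>1\<close>.\<close>

definition symmetric_operator ::
  "('a::euclidean_space \<Rightarrow> real) set \<Rightarrow> (('a \<Rightarrow> real) \<Rightarrow> 'a \<Rightarrow> real) \<Rightarrow> bool" where
  "symmetric_operator D A \<longleftrightarrow>
    (\<forall>f\<in>D. \<forall>g\<in>D. Lnorm \<infinity> f < \<infinity> \<longrightarrow> Lnorm \<infinity> g < \<infinity> \<longrightarrow>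
       (\<integral>x. A f x * g x \<partial>lborel) = (\<integral>x. f x * A g x \<partial>lborel))"

definition nonnegative_operator ::
  "('a::euclidean_space \<Rightarrow> real) set \<Rightarrow> (('a \<Rightarrow> real) \<Rightarrow> 'a \<Rightarrow> real) \<Rightarrow> bool" where
  "nonnegative_operator D A \<longleftrightarrow>
    (\<forall>f\<in>D. Lnorm \<infinity> f < \<infinity> \<longrightarrow> 0 \<le> (\<integral>x. f x * A f x \<partial>lborel))"

definition densely_defined :: "('a::euclidean_space \<Rightarrow> real) set \<Rightarrow> bool" where
  "densely_defined D \<longleftrightarrow>
    (\<forall>f. integrable lborel f \<longrightarrow> (\<forall>\<epsilon>>0. \<exists>g\<in>D. Lnorm 1 (\<lambda>x. f x - g x) < \<epsilon>))"

definition m_accretive ::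
  "('a::euclidean_space \<Rightarrow> real) set \<Rightarrow> (('a \<Rightarrow> real) \<Rightarrow> 'a \<Rightarrow> real) \<Rightarrow> bool" where
  "m_accretive D A \<longleftrightarrow>
    (\<forall>u\<in>D. \<forall>h>0. Lnorm 1 u \<le> Lnorm 1 (\<lambda>x. u x + h * A u x)) \<and>
    (\<forall>h>0. \<forall>f. integrable lborel f \<longrightarrow> (\<exists>u\<in>D. AE x in lborel. u x + h * A u x = f x))"

text \<open>In the following, \<open>u\<close> is \<open>(I + hA)\<^sup>-\<^sup>1 f\<close>.\<close>

definition Dirichlet_operator ::
  "('a::euclidean_space \<Rightarrow> real) set \<Rightarrow> (('a \<Rightarrow> real) \<Rightarrow> 'a \<Rightarrow> real) \<Rightarrow> bool" where
  "Dirichlet_operator D A \<longleftrightarrow>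
    (\<forall>h>0. \<forall>f. \<forall>u\<in>D. \<forall>a b.
       integrable lborel f \<longrightarrow> (AE x in lborel. u x + h * A u x = f x) \<longrightarrow>
       (AE x in lborel. a \<le> f x \<and> f x \<le> b) \<longrightarrow> (AE x in lborel. a \<le> u x \<and> u x \<le> b))"

definition admissible_operator ::
  "('a::euclidean_space \<Rightarrow> real) set \<Rightarrow> (('a \<Rightarrow> real) \<Rightarrow> 'a \<Rightarrow> real) \<Rightarrow> bool" where
  "admissible_operator D A \<longleftrightarrow>
    L1_operator D A \<and> linear_operator D A \<and> symmetric_operator D A \<and>
    nonnegative_operator D A \<and> densely_defined D \<and> m_accretive D A \<and> Dirichlet_operator D A"

definition id_plus :: "(('a \<Rightarrow> real) \<Rightarrow> 'a \<Rightarrow> real) \<Rightarrow> ('a \<Rightarrow> real) \<Rightarrow> 'a \<Rightarrow> real" where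
  "id_plus A f = (\<lambda>x. f x + A f x)"

section \<open>Green functions\<close>

text \<open>By symmetry of \<open>A\<close>, the distribution \<open>A[g]\<close> is \<open>\<psi> \<mapsto> \<integral> g A[\<psi>]\<close>. The equation \<open>A[g] = \<delta>\<close>
  includes that this is defined for every test function.\<close>

definition distributional_delta ::
  "('a::euclidean_space \<Rightarrow> real) set \<Rightarrow> (('a \<Rightarrow> real) \<Rightarrow> 'a \<Rightarrow> real) \<Rightarrow> ('a \<Rightarrow> real) \<Rightarrow> 'a \<Rightarrow> bool" where
  "distributional_delta D A g x0 \<longleftrightarrow>
    (\<forall>\<psi>. test_function \<psi> \<longrightarrow>
       \<psi> \<in> D \<and> integrable lborel (\<lambda>x. g x * A \<psi> x) \<and> (\<integral>x. g x * A \<psi> x \<partial>lborel) = \<psi> x0)"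

definition green_function ::
  "('a::euclidean_space \<Rightarrow> real) set \<Rightarrow> (('a \<Rightarrow> real) \<Rightarrow> 'a \<Rightarrow> real) \<Rightarrow> ('a \<Rightarrow> 'a \<Rightarrow> real) \<Rightarrow> bool" where
  "green_function D A G \<longleftrightarrow>
    (\<forall>x0. locally_integrable (G x0) \<and>
       (AE x in lborel. 0 \<le> G x0 x \<and> G x0 x = G 0 (x - x0) \<and> G x0 x = G 0 (x0 - x)) \<and>
       distributional_delta D A (G x0) x0)"

definition green_inverse ::
  "('a::euclidean_space \<Rightarrow> 'a \<Rightarrow> real) \<Rightarrow> ('a \<Rightarrow> real) \<Rightarrow> 'a \<Rightarrow> real" where
  "green_inverse G f y = (\<integral>x. G 0 (x - y) * f x \<partial>lborel)"

section \<open>Weak dual solutions\<close>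

definition Linfc :: "'a::euclidean_space set \<Rightarrow> ('a \<Rightarrow> real) \<Rightarrow> bool" where
  "Linfc K f \<longleftrightarrow>
    f \<in> borel_measurable borel \<and> Lnorm \<infinity> f < \<infinity> \<and> (AE x in lborel. x \<notin> K \<longrightarrow> f x = 0)"

text \<open>\<open>C\<^sup>1\<^sub>c([\<tau>\<^sub>1,\<tau>\<^sub>2]; L\<^sup>\<infinity>\<^sub>c)\<close>, with \<open>\<psi>'\<close> the time derivative of \<open>\<psi>\<close>: derivative and continuity are
  with respect to the norm of \<open>L\<^sup>\<infinity>\<close>, and the supports of all \<open>\<psi> t\<close> lie in one compact set.
  The representatives of the curves \<open>\<psi>\<close> and \<open>\<psi>'\<close> are taken jointly measurable.\<close>

definition C1c_Linfc ::
  "real \<Rightarrow> real \<Rightarrow> (real \<Rightarrow> 'a::euclidean_space \<Rightarrow> real) \<Rightarrow> (real \<Rightarrow> 'a \<Rightarrow> real) \<Rightarrow> bool" where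
  "C1c_Linfc \<tau>1 \<tau>2 \<psi> \<psi>' \<longleftrightarrow>
    set_borel_measurable lborel ({\<tau>1..\<tau>2} \<times> UNIV) (\<lambda>(t, x). \<psi> t x) \<and>
    set_borel_measurable lborel ({\<tau>1..\<tau>2} \<times> UNIV) (\<lambda>(t, x). \<psi>' t x) \<and>
    (\<exists>K. compact K \<and> (\<forall>t\<in>{\<tau>1..\<tau>2}. Linfc K (\<psi> t) \<and> Linfc K (\<psi>' t))) \<and>
    (\<forall>t\<in>{\<tau>1..\<tau>2}.
       ((\<lambda>s. Lnorm \<infinity> (\<lambda>x. (\<psi> s x - \<psi> t x) / (s - t) - \<psi>' t x)) \<longlongrightarrow> 0) (at t within {\<tau>1..\<tau>2}) \<and>
       ((\<lambda>s. Lnorm \<infinity> (\<lambda>x. \<psi>' s x - \<psi>' t x)) \<longlongrightarrow> 0) (at t within {\<tau>1..\<tau>2}))"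

definition continuous_into_L1 ::
  "real set \<Rightarrow> (real \<Rightarrow> 'a::euclidean_space \<Rightarrow> real) \<Rightarrow> bool" where
  "continuous_into_L1 S u \<longleftrightarrow>
    (\<forall>t\<in>S. integrable lborel (u t) \<and>
       ((\<lambda>s. Lnorm 1 (\<lambda>x. u s x - u t x)) \<longlongrightarrow> 0) (at t within S))"

text \<open>The weak identity between two times; \<open>G\<close> is the Green function of \<open>I - \<LL>\<close>, so that
  \<open>green_inverse G\<close> is \<open>(I - \<LL>)\<^sup>-\<^sup>1\<close>. All integrals are required to converge.\<close>

definition weak_dual_identity ::
  "('a::euclidean_space \<Rightarrow> 'a \<Rightarrow> real) \<Rightarrow> real \<Rightarrow> (real \<Rightarrow> 'a \<Rightarrow> real) \<Rightarrow> real \<Rightarrow> real \<Rightarrow>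
    (real \<Rightarrow> 'a \<Rightarrow> real) \<Rightarrow> (real \<Rightarrow> 'a \<Rightarrow> real) \<Rightarrow> bool" where
  "weak_dual_identity G m u \<tau>1 \<tau>2 \<psi> \<psi>' \<longleftrightarrow>
    set_integrable lborel ({\<tau>1..\<tau>2} \<times> UNIV) (\<lambda>(t, x). green_inverse G (u t) x * \<psi>' t x) \<and>
    set_integrable lborel ({\<tau>1..\<tau>2} \<times> UNIV) (\<lambda>(t, x). u t x powr m * \<psi> t x) \<and>
    set_integrable lborel ({\<tau>1..\<tau>2} \<times> UNIV) (\<lambda>(t, x). u t x powr m * green_inverse G (\<psi> t) x) \<and>
    integrable lborel (\<lambda>x. green_inverse G (u \<tau>1) x * \<psi> \<tau>1 x) \<and>
    integrable lborel (\<lambda>x. green_inverse G (u \<tau>2) x * \<psi> \<tau>2 x) \<and>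
    (LINT t:{\<tau>1..\<tau>2}|lborel. (\<integral>x. green_inverse G (u t) x * \<psi>' t x - u t x powr m * \<psi> t x
          + u t x powr m * green_inverse G (\<psi> t) x \<partial>lborel))
      = (\<integral>x. green_inverse G (u \<tau>2) x * \<psi> \<tau>2 x \<partial>lborel)
        - (\<integral>x. green_inverse G (u \<tau>1) x * \<psi> \<tau>1 x \<partial>lborel)"

definition weak_dual_solution_upto ::
  "('a::euclidean_space \<Rightarrow> 'a \<Rightarrow> real) \<Rightarrow> real \<Rightarrow> ('a \<Rightarrow> real) \<Rightarrow> real \<Rightarrow> (real \<Rightarrow> 'a \<Rightarrow> real) \<Rightarrow> bool" where
  "weak_dual_solution_upto G m u0 T u \<longleftrightarrow>
    set_borel_measurable lborel ({0<..<T} \<times> UNIV) (\<lambda>(t, x). u t x) \<and>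
    (\<forall>t\<in>{0..T}. AE x in lborel. 0 \<le> u t x) \<and>
    continuous_into_L1 {0..T} u \<and>
    (\<forall>K. compact K \<longrightarrow> set_integrable lborel ({0<..<T} \<times> K) (\<lambda>(t, x). u t x powr m)) \<and>
    (AE \<tau> in lborel. case \<tau> of (\<tau>1, \<tau>2) \<Rightarrow>
       0 < \<tau>1 \<and> \<tau>1 \<le> \<tau>2 \<and> \<tau>2 \<le> T \<longrightarrow>
         (\<forall>\<psi> \<psi>'. C1c_Linfc \<tau>1 \<tau>2 \<psi> \<psi>' \<longrightarrow> weak_dual_identity G m u \<tau>1 \<tau>2 \<psi> \<psi>')) \<and>
    (AE x in lborel. u 0 x = u0 x)"

definition weak_dual_solution ::
  "('a::euclidean_space \<Rightarrow> 'a \<Rightarrow> real) \<Rightarrow> real \<Rightarrow> ('a \<Rightarrow> real) \<Rightarrow> (real \<Rightarrow> 'a \<Rightarrow> real) \<Rightarrow> bool" where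
  "weak_dual_solution G m u0 u \<longleftrightarrow> (\<forall>T>0. weak_dual_solution_upto G m u0 T u)"

section \<open>Comparison principle and \<open>L\<^sup>p\<close>-decay\<close>

definition initial_datum :: "('a::euclidean_space \<Rightarrow> real) \<Rightarrow> bool" where
  "initial_datum u0 \<longleftrightarrow> integrable lborel u0 \<and> (AE x in lborel. 0 \<le> u0 x)"

definition comparison_principle :: "('a::euclidean_space \<Rightarrow> 'a \<Rightarrow> real) \<Rightarrow> real \<Rightarrow> bool" where
  "comparison_principle G m \<longleftrightarrow>
    (\<forall>u0 v0 u v. initial_datum u0 \<and> initial_datum v0 \<and>
       weak_dual_solution G m u0 u \<and> weak_dual_solution G m v0 v \<and>
       (AE x in lborel. u0 x \<le> v0 x) \<longrightarrow>
       (AE z in lborel. case z of (t, x) \<Rightarrow> 0 < t \<longrightarrow> u t x \<le> v t x))"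

definition Lp_decay :: "('a::euclidean_space \<Rightarrow> 'a \<Rightarrow> real) \<Rightarrow> real \<Rightarrow> bool" where
  "Lp_decay G m \<longleftrightarrow>
    (\<forall>u0 u. initial_datum u0 \<and> weak_dual_solution G m u0 u \<longrightarrow>
       (\<forall>r\<ge>1. AE \<tau> in lborel. case \<tau> of (\<tau>1, \<tau>2) \<Rightarrow>
          0 \<le> \<tau>1 \<and> \<tau>1 \<le> \<tau>2 \<longrightarrow> Lnorm r (u \<tau>2) \<le> Lnorm r (u \<tau>1)))"

end

theory Submission
  imports Defs
begin

text \<open>
  Write \<open>k\<close> for an even, nonnegative representative of the Green function \<open>G 0\<close>, so that
  \<open>(I - \<LL>)\<^sup>-\<^sup>1\<close> is convolution with \<open>k\<close>. Two facts about a solution \<open>u\<close> carry the proof.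

  The equation is invariant under \<open>u(t, x) \<mapsto> l u(l\<^sup>m\<^sup>-\<^sup>1 t, x)\<close>. For \<open>l \<ge> 1\<close> the scaled solution starts
  above \<open>u\<close>, so the comparison principle shows that \<open>t\<^sup>1\<^sup>/\<^sup>(\<^sup>m\<^sup>-\<^sup>1\<^sup>) u(t)\<close> is nondecreasing in \<open>t\<close>
  (\<open>time_monotonicity\<close>). Testing the weak identity with indicator functions that do not depend on
  time gives, for \<open>F = \<integral> u\<^sup>m dt\<close> over \<open>[t\<^sub>1, t\<^sub>2]\<close>, the identity
  \<open>F + k * u(t\<^sub>2) = k * F + k * u(t\<^sub>1)\<close> (\<open>potential_identity\<close>). By monotonicity in time, \<open>F\<close> lies
  between constant multiples of \<open>u(t\<^sub>1)\<^sup>m\<close> and \<open>u(t\<^sub>2)\<^sup>m\<close>, so that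
  \<open>c u(t\<^sub>1)\<^sup>m \<le> F \<le> k * F + k * u(t\<^sub>1)\<close>.

  Suppose for the moment that \<open>u(t\<^sub>1)\<close> is bounded, with supremum \<open>U\<close>. By decay of the norms, \<open>F\<close> is at
  most \<open>(t\<^sub>2 - t\<^sub>1) U\<^sup>m\<close> and has integral at most \<open>(t\<^sub>2 - t\<^sub>1) U\<^sup>m\<^sup>-\<^sup>1 M\<close>, where \<open>M\<close> is the initial mass.
  An \<open>L\<^sup>p\<close> bound on \<open>k\<close> (\<open>conv_Lp_bound\<close>) then estimates the right-hand side by powers of \<open>U\<close> and
  \<open>M\<close>. With \<open>t\<^sub>2\<close> between \<open>m t\<^sub>1\<close> and \<open>(1 + m) t\<^sub>1\<close> the resulting inequality says that \<open>U\<close> is at most the larger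
  of \<open>((m - 1) t\<^sub>1)\<^sup>-\<^sup>1\<^sup>/\<^sup>(\<^sup>m\<^sup>-\<^sup>1\<^sup>)\<close> and \<open>(C C\<^sub>p)\<^sup>q M\<close> (\<open>smoothing_arithmetic\<close>). These two
  quantities agree at \<open>t\<^sub>0\<close>.

  There is no bounded approximation of \<open>u\<close> at hand, so that \<open>U < \<infinity>\<close> has to be shown for \<open>u\<close> itself.
  On the complement of \<open>E = {u(t\<^sub>2) > h}\<close> the function \<open>F\<close> is at most a multiple of \<open>u(t\<^sub>2)\<close>, hence
  \<open>k * F \<le> F + k * u(t\<^sub>2)\<close> is integrable there. For large \<open>h\<close> the set \<open>E\<close> has small measure, and the
  convolution of \<open>k\<close> with the indicator of the complement is bounded below; since \<open>k\<close> is even, it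
  follows that \<open>F\<close> is integrable (\<open>integrable_of_conv_le\<close>). Finally
  \<open>w = F + u(t\<^sub>1)\<close> satisfies \<open>w \<le> 1 + d (k * w)\<close>. Splitting \<open>k\<close> into a bounded part and a part of small
  mass shows that such an integrable \<open>w\<close> is bounded (\<open>bounded_of_le_conv\<close>).
\<close>

section \<open>Convolution with a nonnegative kernel\<close>

lemma nn_integral_lborel_diff:
  fixes f :: "'a::euclidean_space \<Rightarrow> ennreal"
  assumes [measurable]: "f \<in> borel_measurable borel"
  shows "(\<integral>\<^sup>+x. f (x - y) \<partial>lborel) = (\<integral>\<^sup>+x. f x \<partial>lborel)"
    and "(\<integral>\<^sup>+x. f (y - x) \<partial>lborel) = (\<integral>\<^sup>+x. f x \<partial>lborel)"
proof -
  have "(\<integral>\<^sup>+x. f x \<partial>lborel) = (\<integral>\<^sup>+x. f x \<partial>density (distr lborel borel (\<lambda>x. - y + 1 *\<^sub>R x)) (\<lambda>_. ennreal (\<bar>1\<bar> ^ DIM('a))))"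
    by (subst lborel_affine[of 1 "-y"]) auto
  also have "\<dots> = (\<integral>\<^sup>+x. f (x - y) \<partial>lborel)"
    by (simp add: density_1 nn_integral_distr)
  finally show "(\<integral>\<^sup>+x. f (x - y) \<partial>lborel) = (\<integral>\<^sup>+x. f x \<partial>lborel)" by simp
  have "(\<integral>\<^sup>+x. f x \<partial>lborel) = (\<integral>\<^sup>+x. f x \<partial>density (distr lborel borel (\<lambda>x. y + (-1) *\<^sub>R x)) (\<lambda>_. ennreal (\<bar>-1\<bar> ^ DIM('a))))"
    by (subst lborel_affine[of "-1" y]) auto
  also have "\<dots> = (\<integral>\<^sup>+x. f (y - x) \<partial>lborel)"
    by (simp add: density_1 nn_integral_distr)
  finally show "(\<integral>\<^sup>+x. f (y - x) \<partial>lborel) = (\<integral>\<^sup>+x. f x \<partial>lborel)" by simp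
qed

text \<open>The convolution of a kernel with a nonnegative function, with values in \<open>[0,\<infinity>]\<close>; only the
  positive part of \<open>k\<close> counts.\<close>

definition conv :: "('a::euclidean_space \<Rightarrow> real) \<Rightarrow> ('a \<Rightarrow> ennreal) \<Rightarrow> 'a \<Rightarrow> ennreal" where
  "conv k h x = (\<integral>\<^sup>+y. ennreal (k (x - y)) * h y \<partial>lborel)"

lemma borel_measurable_conv [measurable (raw)]:
  assumes [measurable]: "k \<in> borel_measurable borel" "h \<in> borel_measurable borel"
  shows "conv k h \<in> borel_measurable borel"
  unfolding conv_def by measurable

lemma conv_mono_AE:
  assumes "AE y in lborel. h y \<le> g y"
  shows "conv k h x \<le> conv k g x"
  unfolding conv_def using assms
  by (intro nn_integral_mono_AE) (auto elim!: eventually_mono intro: mult_left_mono)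

lemma conv_add:
  assumes [measurable]: "k \<in> borel_measurable borel" "h \<in> borel_measurable borel" "g \<in> borel_measurable borel"
  shows "conv k (\<lambda>y. h y + g y) x = conv k h x + conv k g x"
  unfolding conv_def by (simp add: distrib_left nn_integral_add)

lemma conv_const:
  assumes [measurable]: "k \<in> borel_measurable borel"
  shows "conv k (\<lambda>_. c) x = (\<integral>\<^sup>+z. ennreal (k z) \<partial>lborel) * c"
  unfolding conv_def
  by (simp add: nn_integral_multc nn_integral_lborel_diff(2)[where f="\<lambda>z. ennreal (k z)"])

lemma conv_commute:
  assumes [measurable]: "k \<in> borel_measurable borel" "h \<in> borel_measurable borel"
    "g \<in> borel_measurable borel"
    and even: "\<And>z. k (- z) = k z"
  shows "(\<integral>\<^sup>+x. conv k h x * g x \<partial>lborel) = (\<integral>\<^sup>+y. h y * conv k g y \<partial>lborel)"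
proof -
  have sym: "k (x - y) = k (y - x)" for x y
    using even[of "x - y"] by simp
  have "(\<integral>\<^sup>+x. conv k h x * g x \<partial>lborel)
      = (\<integral>\<^sup>+x. \<integral>\<^sup>+y. ennreal (k (x - y)) * h y * g x \<partial>lborel \<partial>lborel)"
    unfolding conv_def by (simp add: nn_integral_multc)
  also have "\<dots> = (\<integral>\<^sup>+y. \<integral>\<^sup>+x. ennreal (k (x - y)) * h y * g x \<partial>lborel \<partial>lborel)"
    by (rule lborel_pair.Fubini') simp
  also have "\<dots> = (\<integral>\<^sup>+y. h y * conv k g y \<partial>lborel)"
    unfolding conv_def
    by (simp add: nn_integral_cmult[symmetric] sym mult_ac)
  finally show ?thesis .
qed

lemma nn_integral_conv:
  assumes [measurable]: "k \<in> borel_measurable borel" "h \<in> borel_measurable borel"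
  shows "(\<integral>\<^sup>+x. conv k h x \<partial>lborel) = (\<integral>\<^sup>+z. ennreal (k z) \<partial>lborel) * (\<integral>\<^sup>+y. h y \<partial>lborel)"
proof -
  have "(\<integral>\<^sup>+x. conv k h x \<partial>lborel) = (\<integral>\<^sup>+y. \<integral>\<^sup>+x. ennreal (k (x - y)) * h y \<partial>lborel \<partial>lborel)"
    unfolding conv_def by (rule lborel_pair.Fubini') simp
  also have "\<dots> = (\<integral>\<^sup>+y. (\<integral>\<^sup>+z. ennreal (k z) \<partial>lborel) * h y \<partial>lborel)"
    by (simp add: nn_integral_multc nn_integral_lborel_diff(1)[where f="\<lambda>z. ennreal (k z)"])
  finally show ?thesis by (simp add: nn_integral_cmult)
qed

text \<open>An integrable kernel is the sum of a bounded one and one of small mass.\<close>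

lemma kernel_tail:
  fixes k :: "'a::euclidean_space \<Rightarrow> real"
  assumes [measurable]: "k \<in> borel_measurable borel"
    and fin: "(\<integral>\<^sup>+z. ennreal (k z) \<partial>lborel) < \<infinity>" and e: "0 < e"
  obtains L :: real where "0 < L" "(\<integral>\<^sup>+z. ennreal (if L < k z then k z else 0) \<partial>lborel) \<le> e"
proof -
  have "(\<lambda>n. \<integral>\<^sup>+z. ennreal (if real n < k z then k z else 0) \<partial>lborel) \<longlonglongrightarrow> (\<integral>\<^sup>+z. 0 \<partial>(lborel :: 'a measure))"
  proof (rule nn_integral_dominated_convergence[where w="\<lambda>z. ennreal (k z)"])
    show "AE z in lborel. (\<lambda>n. ennreal (if real n < k z then k z else 0)) \<longlonglongrightarrow> 0"
    proof (rule AE_I2)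
      fix z
      have "\<forall>\<^sub>F n in sequentially. ennreal (if real n < k z then k z else 0) = 0"
        using eventually_ge_at_top[of "nat \<lceil>k z\<rceil>"] by eventually_elim (auto simp: ennreal_eq_0_iff; linarith)
      then show "(\<lambda>n. ennreal (if real n < k z then k z else 0)) \<longlonglongrightarrow> 0"
        by (rule tendsto_eventually)
    qed
  qed (use fin in \<open>auto intro!: AE_I2 simp: ennreal_leI\<close>)
  then have "(\<lambda>n. \<integral>\<^sup>+z. ennreal (if real n < k z then k z else 0) \<partial>lborel) \<longlonglongrightarrow> 0" by simp
  from order_tendstoD(2)[OF this e]
  have "\<forall>\<^sub>F n in sequentially. (\<integral>\<^sup>+z. ennreal (if real n < k z then k z else 0) \<partial>lborel) < e" .
  then obtain N where N: "\<And>n. N \<le> n \<Longrightarrow> (\<integral>\<^sup>+z. ennreal (if real n < k z then k z else 0) \<partial>lborel) < e"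
    by (auto simp: eventually_sequentially)
  show ?thesis
    using N[of "Suc N"] by (intro that[of "real (Suc N)"]) auto
qed

lemma conv_split:
  assumes [measurable]: "k \<in> borel_measurable borel" "h \<in> borel_measurable borel" and L: "0 \<le> L"
  shows "conv k h x \<le> ennreal L * (\<integral>\<^sup>+y. h y \<partial>lborel) + conv (\<lambda>z. if L < k z then k z else 0) h x"
proof -
  have "conv k h x \<le> (\<integral>\<^sup>+y. ennreal L * h y + ennreal (if L < k (x - y) then k (x - y) else 0) * h y \<partial>lborel)"
    unfolding conv_def
  proof (rule nn_integral_mono)
    fix y
    have "ennreal (k (x - y)) \<le> ennreal L + ennreal (if L < k (x - y) then k (x - y) else 0)"
      using L by (auto simp: ennreal_leI)
    from mult_right_mono[OF this, of "h y"]
    show "ennreal (k (x - y)) * h y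
        \<le> ennreal L * h y + ennreal (if L < k (x - y) then k (x - y) else 0) * h y"
      by (simp add: distrib_right)
  qed
  also have "\<dots> = ennreal L * (\<integral>\<^sup>+y. h y \<partial>lborel) + conv (\<lambda>z. if L < k z then k z else 0) h x"
    unfolding conv_def by (simp add: nn_integral_add nn_integral_cmult)
  finally show ?thesis .
qed

section \<open>A priori integrability and boundedness\<close>

text \<open>Only the integrability of the kernel is used. With \<open>k\<^sub>2\<close> the part of small mass, one has
  \<open>h \<le> B + d (k\<^sub>2 * h)\<close>, so that \<open>g = (h - 2 B)\<^sup>+\<close> satisfies \<open>g \<le> d (k\<^sub>2 * g)\<close>; integrating,
  \<open>\<integral> g \<le> (\<integral> g) / 2\<close> and hence \<open>g = 0\<close>.\<close>

lemma bounded_of_le_conv: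
  fixes k :: "'a::euclidean_space \<Rightarrow> real" and d :: real
  assumes [measurable]: "k \<in> borel_measurable borel" "h \<in> borel_measurable borel"
    and k1: "(\<integral>\<^sup>+z. ennreal (k z) \<partial>lborel) < \<infinity>"
    and h1: "(\<integral>\<^sup>+y. h y \<partial>lborel) < \<infinity>"
    and d: "0 < d"
    and le: "AE x in lborel. h x \<le> 1 + ennreal d * conv k h x"
  obtains B :: real where "0 \<le> B" "AE x in lborel. h x \<le> ennreal B"
proof -
  obtain L where L: "0 < L" "(\<integral>\<^sup>+z. ennreal (if L < k z then k z else 0) \<partial>lborel) \<le> ennreal (1 / (2 * d))"
    using kernel_tail[OF assms(1) k1, of "ennreal (1 / (2 * d))"] d by auto
  define k2 where "k2 z = (if L < k z then k z else 0)" for z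
  have [measurable]: "k2 \<in> borel_measurable borel" unfolding k2_def by measurable
  have k2: "(\<integral>\<^sup>+z. ennreal (k2 z) \<partial>lborel) \<le> ennreal (1 / (2 * d))"
    using L(2) by (simp add: k2_def)
  obtain I where I: "(\<integral>\<^sup>+y. h y \<partial>lborel) = ennreal I" "0 \<le> I"
    using h1 by (cases "\<integral>\<^sup>+y. h y \<partial>lborel") auto
  \<comment> \<open>The bounded part of the kernel contributes at most \<open>L I\<close> to the convolution.\<close>
  define B where "B = 1 + d * L * I"
  have B: "0 < B" using d L(1) I(2) by (simp add: B_def add_pos_nonneg)
  define g where "g x = h x - ennreal (2 * B)" for x
  have [measurable]: "g \<in> borel_measurable borel" unfolding g_def by measurable
  have hg: "h x \<le> ennreal (2 * B) + g x" for x
    using ennreal_minus_le_iff[of "h x" "ennreal (2 * B)" "g x"] by (simp add: g_def)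
  have d2: "ennreal d * (\<integral>\<^sup>+z. ennreal (k2 z) \<partial>lborel) \<le> ennreal (1 / 2)"
  proof -
    have "ennreal d * (\<integral>\<^sup>+z. ennreal (k2 z) \<partial>lborel) \<le> ennreal d * ennreal (1 / (2 * d))"
      using k2 by (rule mult_left_mono) simp
    also have "\<dots> = ennreal (1 / 2)"
      using d by (simp add: ennreal_mult[symmetric] del: ennreal_half)
    finally show ?thesis .
  qed
  \<comment> \<open>Convolving the constant \<open>2 B\<close> with the small part costs at most \<open>B\<close>.\<close>
  have gle: "AE x in lborel. g x \<le> ennreal d * conv k2 g x"
    using le
  proof eventually_elim
    case (elim x)
    have "h x \<le> 1 + ennreal d * (ennreal L * ennreal I + conv k2 h x)"
      using elim conv_split[of k h L x] L(1) I
      by (auto simp: k2_def[abs_def] elim!: order_trans intro!: add_left_mono mult_left_mono)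
    also have "\<dots> = ennreal B + ennreal d * conv k2 h x"
      using d L(1) I(2) by (simp add: B_def distrib_left ennreal_mult ennreal_plus mult.assoc add.assoc)
    also have "\<dots> \<le> ennreal B + ennreal d * ((\<integral>\<^sup>+z. ennreal (k2 z) \<partial>lborel) * ennreal (2 * B) + conv k2 g x)"
    proof -
      have "conv k2 h x \<le> conv k2 (\<lambda>y. ennreal (2 * B) + g y) x"
        by (rule conv_mono_AE) (simp add: hg)
      also have "\<dots> = (\<integral>\<^sup>+z. ennreal (k2 z) \<partial>lborel) * ennreal (2 * B) + conv k2 g x"
        by (simp add: conv_add conv_const)
      finally show ?thesis by (intro add_left_mono mult_left_mono) auto
    qed
    also have "\<dots> = ennreal B + (ennreal d * (\<integral>\<^sup>+z. ennreal (k2 z) \<partial>lborel)) * ennreal (2 * B) + ennreal d * conv k2 g x"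
      by (simp add: distrib_left mult.assoc add.assoc)
    also have "\<dots> \<le> ennreal B + ennreal (1 / 2) * ennreal (2 * B) + ennreal d * conv k2 g x"
      by (intro add_mono mult_right_mono d2) auto
    also have "ennreal B + ennreal (1 / 2) * ennreal (2 * B) = ennreal (2 * B)"
      using B by (simp add: ennreal_mult[symmetric] ennreal_plus[symmetric] del: ennreal_plus ennreal_half)
    finally show "g x \<le> ennreal d * conv k2 g x"
      unfolding g_def[of x] by (simp add: ennreal_minus_le_iff)
  qed
  have "(\<integral>\<^sup>+x. g x \<partial>lborel) \<le> (\<integral>\<^sup>+x. ennreal d * conv k2 g x \<partial>lborel)"
    by (rule nn_integral_mono_AE[OF gle])
  also have "\<dots> = (ennreal d * (\<integral>\<^sup>+z. ennreal (k2 z) \<partial>lborel)) * (\<integral>\<^sup>+x. g x \<partial>lborel)"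
    by (simp add: nn_integral_cmult nn_integral_conv mult.assoc)
  also have "\<dots> \<le> ennreal (1 / 2) * (\<integral>\<^sup>+x. g x \<partial>lborel)"
    by (intro mult_right_mono d2) auto
  finally have *: "(\<integral>\<^sup>+x. g x \<partial>lborel) \<le> ennreal (1 / 2) * (\<integral>\<^sup>+x. g x \<partial>lborel)" .
  have "(\<integral>\<^sup>+x. g x \<partial>lborel) \<le> (\<integral>\<^sup>+x. h x \<partial>lborel)"
    by (intro nn_integral_mono) (simp add: g_def diff_le_self_ennreal)
  then obtain J where J: "(\<integral>\<^sup>+x. g x \<partial>lborel) = ennreal J" "0 \<le> J"
    using h1 by (cases "\<integral>\<^sup>+x. g x \<partial>lborel") (auto simp: top_unique)
  have "J \<le> 1 / 2 * J"
    using * J by (simp add: ennreal_mult[symmetric] del: ennreal_half)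
  then have "(\<integral>\<^sup>+x. g x \<partial>lborel) = 0" using J by simp
  then have "AE x in lborel. g x = 0" by (simp add: nn_integral_0_iff_AE)
  then have "AE x in lborel. h x \<le> ennreal (2 * B)"
    by eventually_elim (metis add.right_neutral hg)
  with B show ?thesis by (intro that[of "2 * B"]) auto
qed

text \<open>Hoelder's inequality for the convolution, combined with the interpolation of \<open>L\<^sup>q\<close> between
  \<open>L\<^sup>1\<close> and \<open>L\<^sup>\<infinity>\<close>. Applying Young's inequality to \<open>k / L\<close> alone and optimizing in \<open>L\<close> gives both at
  once with constant \<open>1\<close>.\<close>

lemma conv_Lp_bound:
  fixes k :: "'a::euclidean_space \<Rightarrow> real"
  assumes [measurable]: "k \<in> borel_measurable borel" "h \<in> borel_measurable borel"
    and pos: "\<And>z. 0 \<le> k z"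
    and p: "1 < p" and C: "0 < C" and a: "0 < a" and b: "0 < b"
    and kp: "(\<integral>\<^sup>+z. ennreal (k z powr p) \<partial>lborel) \<le> ennreal (C powr p)"
    and hb: "AE y in lborel. h y \<le> ennreal b" and ha: "(\<integral>\<^sup>+y. h y \<partial>lborel) \<le> ennreal a"
  shows "conv k h x \<le> ennreal (C * b powr (1 / p) * a powr (1 - 1 / p))"
proof -
  \<comment> \<open>This choice balances the two terms of Young's inequality after integration against \<open>h\<close>.\<close>
  define L where "L = C * (b / a) powr (1 / p)"
  have L: "0 < L" using C a b by (simp add: L_def)
  define c where "c = L powr (1 - p) / p"
  have c: "0 \<le> c" using p by (simp add: c_def)
  have young: "k z \<le> L * (1 - 1 / p) + c * k z powr p" for z
  proof -
    define q where "q = p / (p - 1)"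
    have q: "1 < q" "1 / p + 1 / q = 1" using p by (auto simp: q_def field_simps)
    have "k z / L * 1 \<le> (k z / L) powr p / p + 1 powr q / q"
      using p q pos[of z] L by (intro Youngs_inequality) auto
    then have "k z \<le> L * ((k z / L) powr p / p + 1 / q)"
      using L by (simp add: field_simps)
    also have "L * ((k z / L) powr p / p + 1 / q) = L * (1 - 1 / p) + c * k z powr p"
    proof -
      have "1 / q = 1 - 1 / p" using q(2) by simp
      moreover have "L * ((k z / L) powr p / p) = c * k z powr p"
        using L pos[of z] by (simp add: c_def powr_divide powr_diff field_simps)
      ultimately show ?thesis by (simp add: distrib_left)
    qed
    finally show ?thesis .
  qed
  have "conv k h x \<le> (\<integral>\<^sup>+y. ennreal (L * (1 - 1 / p)) * h y + ennreal c * ennreal (k (x - y) powr p) * ennreal b \<partial>lborel)"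
    unfolding conv_def
  proof (rule nn_integral_mono_AE)
    show "AE y in lborel. ennreal (k (x - y)) * h y
       \<le> ennreal (L * (1 - 1 / p)) * h y + ennreal c * ennreal (k (x - y) powr p) * ennreal b"
      using hb
    proof eventually_elim
      case (elim y)
      have "ennreal (k (x - y)) \<le> ennreal (L * (1 - 1 / p)) + ennreal c * ennreal (k (x - y) powr p)"
        using young[of "x - y"] L p c
        by (simp add: ennreal_mult[symmetric] ennreal_plus[symmetric] ennreal_leI del: ennreal_plus)
      then have "ennreal (k (x - y)) * h y
          \<le> (ennreal (L * (1 - 1 / p)) + ennreal c * ennreal (k (x - y) powr p)) * h y"
        by (rule mult_right_mono) simp
      also have "\<dots> \<le> ennreal (L * (1 - 1 / p)) * h y + ennreal c * ennreal (k (x - y) powr p) * ennreal b"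
        unfolding distrib_right using elim by (intro add_mono mult_left_mono) auto
      finally show ?case .
    qed
  qed
  also have "\<dots> = ennreal (L * (1 - 1 / p)) * (\<integral>\<^sup>+y. h y \<partial>lborel)
      + ennreal c * (\<integral>\<^sup>+z. ennreal (k z powr p) \<partial>lborel) * ennreal b"
    by (simp add: nn_integral_add nn_integral_cmult nn_integral_multc
        nn_integral_lborel_diff(2)[where f="\<lambda>z. ennreal (k z powr p)"])
  also have "\<dots> \<le> ennreal (L * (1 - 1 / p)) * ennreal a + ennreal c * ennreal (C powr p) * ennreal b"
    by (intro add_mono mult_left_mono mult_right_mono ha kp) auto
  also have "\<dots> = ennreal (L * (1 - 1 / p) * a + c * C powr p * b)"
    using L p c a b C by (simp add: ennreal_mult ennreal_plus)
  also have "L * (1 - 1 / p) * a + c * C powr p * b = C * b powr (1 / p) * a powr (1 - 1 / p)"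
  proof -
    have La: "L * a = C * b powr (1 / p) * a powr (1 - 1 / p)"
      using a b by (simp add: L_def powr_divide powr_diff)
    have "L powr p = C powr p * (b / a)"
      using C a b p by (simp add: L_def powr_mult powr_powr)
    then have "L powr (1 - p) * C powr p * b = L * a"
      using C a b p L by (simp add: powr_diff)
    then have "c * C powr p * b = L * a / p" by (simp add: c_def)
    then show ?thesis using La p by (simp add: algebra_simps)
  qed
  finally show ?thesis .
qed

text \<open>A function \<open>F\<close> with \<open>k * F \<le> F + k * b\<close> that is dominated by \<open>b\<^sup>m\<close> for an integrable \<open>b\<close> is
  itself integrable: the integral of \<open>k * F\<close> over the set where \<open>b \<le> h\<close> is finite, and for large
  \<open>h\<close> it bounds a multiple of \<open>\<integral> F\<close>.\<close>

lemma integrable_of_conv_le: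
  fixes k b :: "'a::euclidean_space \<Rightarrow> real" and F :: "'a \<Rightarrow> ennreal"
  assumes [measurable]: "k \<in> borel_measurable borel" "b \<in> borel_measurable borel" "F \<in> borel_measurable borel"
    and even: "\<And>z. k (- z) = k z"
    and k0: "(\<integral>\<^sup>+z. ennreal (k z) \<partial>lborel) \<noteq> 0" and k1: "(\<integral>\<^sup>+z. ennreal (k z) \<partial>lborel) < \<infinity>"
    and m: "1 < m" and c: "0 \<le> c"
    and b0: "AE x in lborel. 0 \<le> b x"
    and b1: "(\<integral>\<^sup>+x. ennreal (b x) \<partial>lborel) < \<infinity>"
    and F: "AE x in lborel. F x \<le> ennreal (c * b x powr m)"
    and le: "AE x in lborel. conv k F x \<le> F x + conv k (\<lambda>y. ennreal (b y)) x"
  shows "(\<integral>\<^sup>+x. F x \<partial>lborel) < \<infinity>"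
proof -
  obtain \<kappa> where \<kappa>: "(\<integral>\<^sup>+z. ennreal (k z) \<partial>lborel) = ennreal \<kappa>" "0 < \<kappa>"
    using k0 k1 by (cases "\<integral>\<^sup>+z. ennreal (k z) \<partial>lborel") (auto simp: less_le)
  obtain I where I: "(\<integral>\<^sup>+x. ennreal (b x) \<partial>lborel) = ennreal I" "0 \<le> I"
    using b1 by (cases "\<integral>\<^sup>+x. ennreal (b x) \<partial>lborel") auto
  obtain L where L: "0 < L" "(\<integral>\<^sup>+z. ennreal (if L < k z then k z else 0) \<partial>lborel) \<le> ennreal (\<kappa> / 4)"
    using kernel_tail[OF assms(1) k1, of "ennreal (\<kappa> / 4)"] \<kappa>(2) by auto
  \<comment> \<open>By Markov's inequality \<open>E\<close> below has measure at most \<open>I / h\<close>, so that \<open>L\<close> times it is at most \<open>\<kappa> / 4\<close>.\<close>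
  define h where "h = 4 * L * (I + 1) / \<kappa>"
  have h: "0 < h" using L(1) I(2) \<kappa>(2) by (simp add: h_def)
  define E where "E = {x. h < b x}"
  have [measurable]: "E \<in> sets borel" unfolding E_def by measurable
  have emE: "emeasure lborel E \<le> ennreal (I / h)"
  proof -
    have "emeasure lborel E = (\<integral>\<^sup>+x. indicator E x \<partial>lborel)" by simp
    also have "\<dots> \<le> (\<integral>\<^sup>+x. ennreal (1 / h) * ennreal (b x) \<partial>lborel)"
      using h by (intro nn_integral_mono)
        (auto simp: E_def indicator_def ennreal_mult[symmetric] field_simps simp flip: ennreal_1)
    also have "\<dots> = ennreal (1 / h) * ennreal I"
      by (simp add: nn_integral_cmult I)
    finally show ?thesis using h I(2) by (simp add: ennreal_mult[symmetric])
  qed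
  have KE: "conv k (indicator E) x \<le> ennreal (\<kappa> / 2)" for x
  proof -
    have "conv k (indicator E) x \<le> ennreal L * emeasure lborel E
        + conv (\<lambda>z. if L < k z then k z else 0) (indicator E) x"
      using conv_split[of k "indicator E" L x] L(1) by simp
    also have "conv (\<lambda>z. if L < k z then k z else 0) (indicator E) x
        \<le> conv (\<lambda>z. if L < k z then k z else 0) (\<lambda>_. 1) x"
      by (rule conv_mono_AE) (auto simp: indicator_def)
    also have "\<dots> \<le> ennreal (\<kappa> / 4)"
      using L(2) by (simp add: conv_const)
    also have "ennreal L * emeasure lborel E \<le> ennreal L * ennreal (I / h)"
      using emE by (rule mult_left_mono) simp
    also have "\<dots> = ennreal (L * (I / h))" using L(1) I(2) h by (simp add: ennreal_mult[symmetric])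
    also have "\<dots> \<le> ennreal (\<kappa> / 4)"
    proof (rule ennreal_leI)
      have "L * (I / h) = \<kappa> / 4 * (I / (I + 1))"
        using L(1) I(2) \<kappa>(2) by (simp add: h_def)
      also have "\<dots> \<le> \<kappa> / 4 * 1"
        using I(2) \<kappa>(2) by (intro mult_left_mono) auto
      finally show "L * (I / h) \<le> \<kappa> / 4" by simp
    qed
    finally show ?thesis using \<kappa>(2) by (simp add: ennreal_plus[symmetric] add_right_mono del: ennreal_plus)
  qed
  have KEc: "ennreal (\<kappa> / 2) \<le> conv k (indicator (- E)) x" for x
  proof -
    have "ennreal \<kappa> = conv k (\<lambda>y. indicator E y + indicator (- E) y) x"
    proof -
      have "(\<lambda>y. indicator E y + indicator (- E) y) = (\<lambda>y. 1 :: ennreal)"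
        by (auto simp: indicator_def)
      then show ?thesis using conv_const[of k 1 x] \<kappa>(1) by simp
    qed
    also have "\<dots> = conv k (indicator E) x + conv k (indicator (- E)) x"
      by (rule conv_add) auto
    also have "\<dots> \<le> ennreal (\<kappa> / 2) + conv k (indicator (- E)) x"
      by (intro add_right_mono KE)
    finally have "ennreal \<kappa> - ennreal (\<kappa> / 2) \<le> conv k (indicator (- E)) x"
      by (simp add: ennreal_minus_le_iff)
    then show ?thesis using \<kappa>(2) by (simp add: ennreal_minus)
  qed
  have FEc: "(\<integral>\<^sup>+x. F x * indicator (- E) x \<partial>lborel) \<le> ennreal (c * h powr (m - 1)) * ennreal I"
  proof -
    have "(\<integral>\<^sup>+x. F x * indicator (- E) x \<partial>lborel)
        \<le> (\<integral>\<^sup>+x. ennreal (c * h powr (m - 1)) * ennreal (b x) \<partial>lborel)"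
    proof (rule nn_integral_mono_AE)
      show "AE x in lborel. F x * indicator (- E) x \<le> ennreal (c * h powr (m - 1)) * ennreal (b x)"
        using F b0
      proof eventually_elim
        case (elim x)
        show ?case
        proof (cases "x \<in> E")
          case False
          then have bh: "b x \<le> h" by (simp add: E_def)
          have "b x powr m = b x powr (m - 1) * b x"
            using elim(2) by (cases "b x = 0") (auto simp: powr_diff)
          also have "\<dots> \<le> h powr (m - 1) * b x"
            using elim(2) bh m by (intro mult_right_mono powr_mono2) auto
          finally have "c * b x powr m \<le> c * h powr (m - 1) * b x"
            using c by (simp add: mult.assoc mult_left_mono)
          then have "F x \<le> ennreal (c * h powr (m - 1) * b x)"
            using elim(1) by (meson ennreal_leI order_trans)
          then show ?thesis using False c by (simp add: ennreal_mult' elim(2))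
        qed simp
      qed
    qed
    then show ?thesis by (simp add: nn_integral_cmult I)
  qed
  have "ennreal (\<kappa> / 2) * (\<integral>\<^sup>+x. F x \<partial>lborel) = (\<integral>\<^sup>+x. F x * ennreal (\<kappa> / 2) \<partial>lborel)"
    by (simp add: nn_integral_multc mult.commute)
  also have "\<dots> \<le> (\<integral>\<^sup>+x. F x * conv k (indicator (- E)) x \<partial>lborel)"
    by (intro nn_integral_mono mult_left_mono KEc) auto
  also have "\<dots> = (\<integral>\<^sup>+x. conv k F x * indicator (- E) x \<partial>lborel)"
    by (rule conv_commute[symmetric]) (auto simp: even)
  also have "\<dots> \<le> (\<integral>\<^sup>+x. F x * indicator (- E) x + conv k (\<lambda>y. ennreal (b y)) x \<partial>lborel)"
    using le by (intro nn_integral_mono_AE) (auto elim!: eventually_mono simp: indicator_def)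
  also have "\<dots> \<le> ennreal (c * h powr (m - 1)) * ennreal I + ennreal \<kappa> * ennreal I"
    using FEc by (simp add: nn_integral_add nn_integral_conv \<kappa> I add_right_mono)
  also have "\<dots> < \<infinity>" by (simp add: ennreal_mult_less_top ennreal_add_less_top)
  finally show ?thesis
    using \<kappa>(2) by (auto simp: ennreal_mult_less_top ennreal_eq_0_iff)
qed

section \<open>Scaling of time\<close>

text \<open>No measurability of \<open>P\<close> is required.\<close>

lemma AE_lborel_scaleR:
  fixes P :: "'a::euclidean_space \<Rightarrow> bool"
  assumes P: "AE x in lborel. P x" and c: "c \<noteq> 0"
  shows "AE x in lborel. P (c *\<^sub>R x)"
proof -
  obtain N where N: "N \<in> null_sets lborel" "{x. \<not> P x} \<subseteq> N"
    using P by (auto simp: eventually_ae_filter)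
  have [measurable]: "N \<in> sets borel" using N(1) by auto
  have "AE x in lborel. x \<notin> N" using AE_not_in[OF N(1)] .
  then have "AE x in density (distr lborel borel (\<lambda>x. 0 + c *\<^sub>R x)) (\<lambda>_. ennreal (\<bar>c\<bar> ^ DIM('a))). x \<notin> N"
    by (subst (asm) lborel_affine[OF c, of 0])
  then have "AE x in lborel. c *\<^sub>R x \<notin> N"
    using c by (simp add: AE_density AE_distr_iff)
  then show ?thesis by (rule eventually_mono) (use N(2) in auto)
qed

lemma measurable_scale_fst:
  "(\<lambda>z :: real \<times> 'a::euclidean_space. (c * fst z, snd z)) \<in> borel \<rightarrow>\<^sub>M borel"
  by (intro borel_measurable_continuous_onI continuous_intros)

lemma nn_integral_lborel_scale_fst:
  fixes f :: "real \<times> 'a::euclidean_space \<Rightarrow> ennreal"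
  assumes [measurable]: "f \<in> borel_measurable borel" and c: "c \<noteq> 0"
  shows "(\<integral>\<^sup>+z. f z \<partial>lborel) = ennreal \<bar>c\<bar> * (\<integral>\<^sup>+z. f (c * fst z, snd z) \<partial>lborel)"
proof -
  have [measurable]: "f \<in> borel_measurable (borel \<Otimes>\<^sub>M borel)" by (simp add: borel_prod)
  have [measurable]: "f \<in> borel_measurable (lborel \<Otimes>\<^sub>M lborel)" by (simp add: lborel_prod)
  have "(\<integral>\<^sup>+z. f z \<partial>lborel) = (\<integral>\<^sup>+t. \<integral>\<^sup>+x. f (t, x) \<partial>lborel \<partial>lborel)"
    unfolding lborel_prod[symmetric] by (rule lborel.nn_integral_fst[symmetric]) simp
  also have "\<dots> = ennreal \<bar>c\<bar> * (\<integral>\<^sup>+t. \<integral>\<^sup>+x. f (c * t, x) \<partial>lborel \<partial>lborel)"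
    by (subst nn_integral_real_affine[OF _ c, where t=0]) (auto simp: lborel.borel_measurable_nn_integral_fst)
  also have "(\<integral>\<^sup>+t. \<integral>\<^sup>+x. f (c * t, x) \<partial>lborel \<partial>lborel) = (\<integral>\<^sup>+z. f (c * fst z, snd z) \<partial>lborel)"
    unfolding lborel_prod[symmetric]
    by (subst lborel.nn_integral_fst[where f="\<lambda>z. f (c * fst z, snd z)", symmetric]) simp_all
  finally show ?thesis .
qed

lemma integrable_lborel_scale_fst:
  fixes f :: "real \<times> 'a::euclidean_space \<Rightarrow> real"
  assumes f: "integrable lborel f" and c: "c \<noteq> 0"
  shows "integrable lborel (\<lambda>z. f (c * fst z, snd z))"
proof -
  have [measurable]: "f \<in> borel_measurable borel" using f by auto
  have "(\<lambda>z. f (c * fst z, snd z)) \<in> borel_measurable borel"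
    by (rule measurable_compose[OF measurable_scale_fst]) simp
  then have [measurable]: "(\<lambda>z. f (c * fst z, snd z)) \<in> borel_measurable lborel" by simp
  have "(\<integral>\<^sup>+z. ennreal (norm (f z)) \<partial>lborel) < \<infinity>"
    using f by (simp add: integrable_iff_bounded)
  then have "(\<integral>\<^sup>+z. ennreal (norm (f (c * fst z, snd z))) \<partial>lborel) < \<infinity>"
    using c by (subst (asm) nn_integral_lborel_scale_fst[OF _ c]) (auto simp: ennreal_mult_less_top)
  then show ?thesis by (intro integrableI_bounded) simp_all
qed

lemma set_borel_measurable_scale_fst:
  fixes f :: "real \<Rightarrow> 'a::euclidean_space \<Rightarrow> real"
  assumes f: "set_borel_measurable lborel (S \<times> K) (\<lambda>(t, x). f t x)"
    and S: "\<And>t. t \<in> S' \<longleftrightarrow> c * t \<in> S"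
  shows "set_borel_measurable lborel (S' \<times> K) (\<lambda>(t, x). f (c * t) x)"
proof -
  have [measurable]: "(\<lambda>z. indicator (S \<times> K) z *\<^sub>R (case z of (t, x) \<Rightarrow> f t x)) \<in> borel_measurable borel"
    using f by (simp add: set_borel_measurable_def)
  have "(\<lambda>z. (\<lambda>z. indicator (S \<times> K) z *\<^sub>R (case z of (t, x) \<Rightarrow> f t x)) (c * fst z, snd z))
      \<in> borel_measurable borel"
    by (rule measurable_compose[OF measurable_scale_fst]) measurable
  also have "(\<lambda>z. (\<lambda>z. indicator (S \<times> K) z *\<^sub>R (case z of (t, x) \<Rightarrow> f t x)) (c * fst z, snd z))
     = (\<lambda>z. indicator (S' \<times> K) z *\<^sub>R (case z of (t, x) \<Rightarrow> f (c * t) x))"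
    by (auto simp: S indicator_def)
  finally show ?thesis by (simp add: set_borel_measurable_def)
qed

lemma set_integrable_scale_fst:
  fixes f :: "real \<Rightarrow> 'a::euclidean_space \<Rightarrow> real"
  assumes f: "set_integrable lborel (S \<times> K) (\<lambda>(t, x). f t x)" and c: "c \<noteq> 0"
    and S: "\<And>t. t \<in> S' \<longleftrightarrow> c * t \<in> S"
  shows "set_integrable lborel (S' \<times> K) (\<lambda>(t, x). f (c * t) x)"
proof -
  have "(\<lambda>z. (\<lambda>z. indicator (S \<times> K) z *\<^sub>R (case z of (t, x) \<Rightarrow> f t x)) (c * fst z, snd z))
     = (\<lambda>z. indicator (S' \<times> K) z *\<^sub>R (case z of (t, x) \<Rightarrow> f (c * t) x))"
    by (auto simp: S indicator_def)
  then show ?thesis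
    using integrable_lborel_scale_fst[OF f[unfolded set_integrable_def] c]
    by (simp add: set_integrable_def)
qed

lemma set_lebesgue_integral_scale:
  fixes f :: "real \<Rightarrow> real"
  assumes c: "0 < c" and S: "\<And>t. t \<in> S' \<longleftrightarrow> c * t \<in> S"
  shows "(LINT t:S|lborel. f t) = c * (LINT t:S'|lborel. f (c * t))"
  unfolding set_lebesgue_integral_def
  using lborel_integral_real_affine[of c "\<lambda>t. indicator S t *\<^sub>R f t" 0] c
  by (simp add: S indicator_def)

section \<open>Norms\<close>

lemma Lnorm_1: "Lnorm 1 f = (\<integral>\<^sup>+x. ennreal \<bar>f x\<bar> \<partial>lborel)"
  by (cases "\<integral>\<^sup>+x. ennreal \<bar>f x\<bar> \<partial>lborel") (auto simp: Lnorm_def)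

lemma Lnorm_1_cmult:
  assumes "f \<in> borel_measurable borel"
  shows "Lnorm 1 (\<lambda>x. c * f x) = ennreal \<bar>c\<bar> * Lnorm 1 f"
  using assms by (simp add: Lnorm_1 abs_mult ennreal_mult nn_integral_cmult)

lemma Lnorm_infinity_cmult_le:
  assumes c: "0 < c"
  shows "Lnorm \<infinity> (\<lambda>x. c * f x) \<le> ennreal c * Lnorm \<infinity> f"
proof (cases "(\<lambda>x. ennreal \<bar>f x\<bar>) \<in> borel_measurable lborel")
  case True
  then have [measurable]: "(\<lambda>x. ennreal \<bar>f x\<bar>) \<in> borel_measurable borel" by simp
  have eq: "ennreal \<bar>c * f x\<bar> = ennreal c * ennreal \<bar>f x\<bar>" for x
    using c by (simp add: abs_mult ennreal_mult)
  have "AE x in lborel. ennreal c * ennreal \<bar>f x\<bar> \<le> ennreal c * esssup lborel (\<lambda>x. ennreal \<bar>f x\<bar>)"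
    using esssup_AE[of "\<lambda>x. ennreal \<bar>f x\<bar>" lborel] by eventually_elim (rule mult_left_mono, auto)
  then show ?thesis
    unfolding Lnorm_def by (auto simp: eq intro!: esssup_I)
next
  case False
  then have "Lnorm \<infinity> f = top" by (simp add: Lnorm_def esssup_non_measurable)
  then show ?thesis using c by (simp add: ennreal_mult_top)
qed

section \<open>Scaling invariance of the equation\<close>

lemma C1c_Linfc_scale:
  fixes \<psi> \<psi>' :: "real \<Rightarrow> 'a::euclidean_space \<Rightarrow> real"
  assumes \<psi>: "C1c_Linfc a b \<psi> \<psi>'" and \<mu>: "0 < \<mu>"
  shows "C1c_Linfc (\<mu> * a) (\<mu> * b) (\<lambda>t x. \<psi> (1 / \<mu> * t) x) (\<lambda>t x. 1 / \<mu> * \<psi>' (1 / \<mu> * t) x)"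
proof -
  have mem: "t \<in> {\<mu> * a..\<mu> * b} \<longleftrightarrow> 1 / \<mu> * t \<in> {a..b}" for t
    using \<mu> by (auto simp: field_simps)
  have lim: "filterlim (\<lambda>s. 1 / \<mu> * s) (at (1 / \<mu> * t) within {a..b}) (at t within {\<mu> * a..\<mu> * b})" for t
  proof -
    have "((\<lambda>s. 1 / \<mu> * s) \<longlongrightarrow> 1 / \<mu> * t) (at t within {\<mu> * a..\<mu> * b})"
      by (intro tendsto_intros)
    moreover have "\<forall>\<^sub>F s in at t within {\<mu> * a..\<mu> * b}. 1 / \<mu> * s \<in> {a..b} \<and> 1 / \<mu> * s \<noteq> 1 / \<mu> * t"
      using \<mu> mem by (simp add: eventually_at_filter)
    ultimately show ?thesis by (simp add: filterlim_at)
  qed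
  have scaled: "((\<lambda>s. Lnorm \<infinity> (g s)) \<longlongrightarrow> 0) (at t within {\<mu> * a..\<mu> * b})"
    if f: "((\<lambda>s. Lnorm \<infinity> (f s)) \<longlongrightarrow> 0) (at (1 / \<mu> * t) within {a..b})"
      and g: "\<And>s. g s = (\<lambda>x. 1 / \<mu> * f (1 / \<mu> * s) x)"
    for t :: real and f g :: "real \<Rightarrow> 'a \<Rightarrow> real"
  proof (rule tendsto_sandwich[OF _ _ tendsto_const])
    have "((\<lambda>s. Lnorm \<infinity> (f (1 / \<mu> * s))) \<longlongrightarrow> 0) (at t within {\<mu> * a..\<mu> * b})"
      by (rule filterlim_compose[OF f lim])
    then show "((\<lambda>s. ennreal (1 / \<mu>) * Lnorm \<infinity> (f (1 / \<mu> * s))) \<longlongrightarrow> 0) (at t within {\<mu> * a..\<mu> * b})"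
      using ennreal_tendsto_cmult[of "ennreal (1 / \<mu>)"] by fastforce
    show "\<forall>\<^sub>F s in at t within {\<mu> * a..\<mu> * b}. Lnorm \<infinity> (g s) \<le> ennreal (1 / \<mu>) * Lnorm \<infinity> (f (1 / \<mu> * s))"
      unfolding g using \<mu> by (intro always_eventually allI Lnorm_infinity_cmult_le) simp
  qed simp
  obtain K where K: "compact K" "\<And>t. t \<in> {a..b} \<Longrightarrow> Linfc K (\<psi> t)" "\<And>t. t \<in> {a..b} \<Longrightarrow> Linfc K (\<psi>' t)"
    using \<psi> unfolding C1c_Linfc_def by blast
  have Linfc_scale: "Linfc K (\<lambda>x. 1 / \<mu> * f x)" if "Linfc K f" for f :: "'a \<Rightarrow> real"
  proof -
    have "Lnorm \<infinity> (\<lambda>x. 1 / \<mu> * f x) \<le> ennreal (1 / \<mu>) * Lnorm \<infinity> f"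
      using \<mu> by (intro Lnorm_infinity_cmult_le) simp
    also have "\<dots> < \<infinity>" using that by (simp add: Linfc_def ennreal_mult_less_top)
    finally show ?thesis using that by (auto simp: Linfc_def)
  qed
  show ?thesis
    unfolding C1c_Linfc_def
  proof (intro conjI ballI)
    show "set_borel_measurable lborel ({\<mu> * a..\<mu> * b} \<times> UNIV) (\<lambda>(t, x). \<psi> (1 / \<mu> * t) x)"
      using \<psi> by (intro set_borel_measurable_scale_fst[OF _ mem]) (simp add: C1c_Linfc_def)
    have "set_borel_measurable lborel ({\<mu> * a..\<mu> * b} \<times> UNIV) (\<lambda>(t, x). \<psi>' (1 / \<mu> * t) x)"
      using \<psi> by (intro set_borel_measurable_scale_fst[OF _ mem]) (simp add: C1c_Linfc_def)
    then have "(\<lambda>z. 1 / \<mu> * (indicator ({\<mu> * a..\<mu> * b} \<times> UNIV) z *\<^sub>R (case z of (t, x) \<Rightarrow> \<psi>' (1 / \<mu> * t) x)))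
        \<in> borel_measurable lborel"
      unfolding set_borel_measurable_def by (intro borel_measurable_times borel_measurable_const)
    then show "set_borel_measurable lborel ({\<mu> * a..\<mu> * b} \<times> UNIV) (\<lambda>(t, x). 1 / \<mu> * \<psi>' (1 / \<mu> * t) x)"
      unfolding set_borel_measurable_def by (simp add: case_prod_unfold mult_ac)
    show "\<exists>K. compact K \<and> (\<forall>t\<in>{\<mu> * a..\<mu> * b}. Linfc K (\<psi> (1 / \<mu> * t)) \<and> Linfc K (\<lambda>x. 1 / \<mu> * \<psi>' (1 / \<mu> * t) x))"
      using K Linfc_scale mem by blast
    fix t assume "t \<in> {\<mu> * a..\<mu> * b}"
    then have t: "1 / \<mu> * t \<in> {a..b}" using mem by blast
    show "((\<lambda>s. Lnorm \<infinity> (\<lambda>x. (\<psi> (1 / \<mu> * s) x - \<psi> (1 / \<mu> * t) x) / (s - t) - 1 / \<mu> * \<psi>' (1 / \<mu> * t) x))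
        \<longlongrightarrow> 0) (at t within {\<mu> * a..\<mu> * b})"
    proof (rule scaled[where f = "\<lambda>s x. (\<psi> s x - \<psi> (1 / \<mu> * t) x) / (s - 1 / \<mu> * t) - \<psi>' (1 / \<mu> * t) x"])
      show "((\<lambda>s. Lnorm \<infinity> (\<lambda>x. (\<psi> s x - \<psi> (1 / \<mu> * t) x) / (s - 1 / \<mu> * t) - \<psi>' (1 / \<mu> * t) x)) \<longlongrightarrow> 0)
          (at (1 / \<mu> * t) within {a..b})"
        using \<psi> t unfolding C1c_Linfc_def by blast
      fix s
      show "(\<lambda>x. (\<psi> (1 / \<mu> * s) x - \<psi> (1 / \<mu> * t) x) / (s - t) - 1 / \<mu> * \<psi>' (1 / \<mu> * t) x)
        = (\<lambda>x. 1 / \<mu> * ((\<psi> (1 / \<mu> * s) x - \<psi> (1 / \<mu> * t) x) / (1 / \<mu> * s - 1 / \<mu> * t) - \<psi>' (1 / \<mu> * t) x))"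
      proof -
        have "X / (s - t) - 1 / \<mu> * Y = 1 / \<mu> * (X / (1 / \<mu> * (s - t)) - Y)" for X Y
          using \<mu> by (cases "s = t") (simp_all add: field_simps)
        then show ?thesis by (simp only: right_diff_distrib)
      qed
    qed
    show "((\<lambda>s. Lnorm \<infinity> (\<lambda>x. 1 / \<mu> * \<psi>' (1 / \<mu> * s) x - 1 / \<mu> * \<psi>' (1 / \<mu> * t) x)) \<longlongrightarrow> 0)
        (at t within {\<mu> * a..\<mu> * b})"
    proof (rule scaled[where f = "\<lambda>s x. \<psi>' s x - \<psi>' (1 / \<mu> * t) x"])
      show "((\<lambda>s. Lnorm \<infinity> (\<lambda>x. \<psi>' s x - \<psi>' (1 / \<mu> * t) x)) \<longlongrightarrow> 0) (at (1 / \<mu> * t) within {a..b})"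
        using \<psi> t unfolding C1c_Linfc_def by blast
    qed (simp add: right_diff_distrib)
  qed
qed

lemma green_inverse_cmult: "green_inverse G (\<lambda>x. c * f x) y = c * green_inverse G f y"
  by (simp add: green_inverse_def mult.left_commute)

text \<open>The factor \<open>\<mu>\<close> from the change of variables in time combines with the factor \<open>l\<close> of the other
  terms into \<open>l\<^sup>m\<close>, the factor by which \<open>u\<^sup>m\<close> scales.\<close>

lemma weak_dual_identity_scale:
  fixes u \<psi> \<psi>' :: "real \<Rightarrow> 'a::euclidean_space \<Rightarrow> real"
  assumes l: "0 < l" and \<mu>: "\<mu> = l powr (m - 1)"
    and id: "weak_dual_identity G m u (\<mu> * a) (\<mu> * b)
      (\<lambda>t x. \<psi> (1 / \<mu> * t) x) (\<lambda>t x. 1 / \<mu> * \<psi>' (1 / \<mu> * t) x)"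
  shows "weak_dual_identity G m (\<lambda>t x. l * u (\<mu> * t) x) a b \<psi> \<psi>'"
proof -
  have \<mu>0: "0 < \<mu>" using l by (simp add: \<mu>)
  have lm: "l powr m = l * \<mu>" using l by (simp add: \<mu> powr_diff)
  have mem: "t \<in> {a..b} \<longleftrightarrow> \<mu> * t \<in> {\<mu> * a..\<mu> * b}" for t
    using \<mu>0 by auto
  note id = id[unfolded weak_dual_identity_def]
  have scaled: "set_integrable lborel ({a..b} \<times> UNIV) (\<lambda>(t, x). c * f (\<mu> * t) x)"
    if "set_integrable lborel ({\<mu> * a..\<mu> * b} \<times> UNIV) (\<lambda>(t, x). f t x)"
    for c and f :: "real \<Rightarrow> 'a \<Rightarrow> real"
  proof -
    have "set_integrable lborel ({a..b} \<times> UNIV) (\<lambda>(t, x). f (\<mu> * t) x)"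
      using that \<mu>0 by (intro set_integrable_scale_fst[OF _ _ mem]) auto
    then have "set_integrable lborel ({a..b} \<times> UNIV) (\<lambda>z. c * (case z of (t, x) \<Rightarrow> f (\<mu> * t) x))"
      by (rule set_integrable_mult_right)
    then show ?thesis by (simp add: case_prod_unfold)
  qed
  have int: "(LINT t:{a..b}|lborel. (\<integral>x. green_inverse G (\<lambda>x. l * u (\<mu> * t) x) x * \<psi>' t x
        - (l * u (\<mu> * t) x) powr m * \<psi> t x
        + (l * u (\<mu> * t) x) powr m * green_inverse G (\<psi> t) x \<partial>lborel))
     = l * (LINT t:{\<mu> * a..\<mu> * b}|lborel. (\<integral>x. green_inverse G (u t) x * (1 / \<mu> * \<psi>' (1 / \<mu> * t) x)
        - u t x powr m * \<psi> (1 / \<mu> * t) x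
        + u t x powr m * green_inverse G (\<psi> (1 / \<mu> * t)) x \<partial>lborel))" (is "?L = l * ?R")
  proof -
    have "?L = (LINT t:{a..b}|lborel. l * (\<mu> * (\<integral>x. green_inverse G (u (\<mu> * t)) x * (1 / \<mu> * \<psi>' (1 / \<mu> * (\<mu> * t)) x)
        - u (\<mu> * t) x powr m * \<psi> (1 / \<mu> * (\<mu> * t)) x
        + u (\<mu> * t) x powr m * green_inverse G (\<psi> (1 / \<mu> * (\<mu> * t))) x \<partial>lborel)))"
      unfolding integral_mult_right_zero[symmetric] green_inverse_cmult powr_mult lm
      using \<mu>0 by (simp add: algebra_simps)
    also have "\<dots> = l * (\<mu> * (LINT t:{a..b}|lborel. (\<integral>x. green_inverse G (u (\<mu> * t)) x * (1 / \<mu> * \<psi>' (1 / \<mu> * (\<mu> * t)) x)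
        - u (\<mu> * t) x powr m * \<psi> (1 / \<mu> * (\<mu> * t)) x
        + u (\<mu> * t) x powr m * green_inverse G (\<psi> (1 / \<mu> * (\<mu> * t))) x \<partial>lborel)))"
      by simp
    also have "\<dots> = l * ?R"
      by (subst set_lebesgue_integral_scale[OF \<mu>0 mem]) simp
    finally show ?thesis .
  qed
  show ?thesis
    unfolding weak_dual_identity_def
  proof (intro conjI)
    show "set_integrable lborel ({a..b} \<times> UNIV) (\<lambda>(t, x). green_inverse G (\<lambda>x. l * u (\<mu> * t) x) x * \<psi>' t x)"
      using scaled[of "\<lambda>t x. green_inverse G (u t) x * (1 / \<mu> * \<psi>' (1 / \<mu> * t) x)" "l * \<mu>"] id \<mu>0
      by (simp add: green_inverse_cmult mult.assoc mult.left_commute[of \<mu>])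
    show "set_integrable lborel ({a..b} \<times> UNIV) (\<lambda>(t, x). (l * u (\<mu> * t) x) powr m * \<psi> t x)"
      using scaled[of "\<lambda>t x. u t x powr m * \<psi> (1 / \<mu> * t) x" "l powr m"] id \<mu>0
      by (simp add: powr_mult mult.assoc)
    show "set_integrable lborel ({a..b} \<times> UNIV) (\<lambda>(t, x). (l * u (\<mu> * t) x) powr m * green_inverse G (\<psi> t) x)"
      using scaled[of "\<lambda>t x. u t x powr m * green_inverse G (\<psi> (1 / \<mu> * t)) x" "l powr m"] id \<mu>0
      by (simp add: powr_mult mult.assoc)
    show "integrable lborel (\<lambda>x. green_inverse G (\<lambda>x. l * u (\<mu> * a) x) x * \<psi> a x)"
      using id \<mu>0 by (simp add: green_inverse_cmult mult.assoc)
    show "integrable lborel (\<lambda>x. green_inverse G (\<lambda>x. l * u (\<mu> * b) x) x * \<psi> b x)"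
      using id \<mu>0 by (simp add: green_inverse_cmult mult.assoc)
    have "?L = l * ?R" by (rule int)
    also have "?R = (\<integral>x. green_inverse G (u (\<mu> * b)) x * \<psi> (1 / \<mu> * (\<mu> * b)) x \<partial>lborel)
        - (\<integral>x. green_inverse G (u (\<mu> * a)) x * \<psi> (1 / \<mu> * (\<mu> * a)) x \<partial>lborel)"
      using id by blast
    finally show "?L = (\<integral>x. green_inverse G (\<lambda>x. l * u (\<mu> * b) x) x * \<psi> b x \<partial>lborel)
        - (\<integral>x. green_inverse G (\<lambda>x. l * u (\<mu> * a) x) x * \<psi> a x \<partial>lborel)"
      using \<mu>0 by (simp add: green_inverse_cmult mult.assoc right_diff_distrib)
  qed
qed

text \<open>The equation is invariant under \<open>u \<mapsto> l u(l\<^sup>m\<^sup>-\<^sup>1 t, x)\<close>.\<close>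

lemma weak_dual_solution_scale:
  fixes u :: "real \<Rightarrow> 'a::euclidean_space \<Rightarrow> real"
  assumes u: "weak_dual_solution G m u0 u" and l: "0 < l"
  shows "weak_dual_solution G m (\<lambda>x. l * u0 x) (\<lambda>t x. l * u (l powr (m - 1) * t) x)"
  unfolding weak_dual_solution_def
proof (intro allI impI)
  fix T :: real assume T: "0 < T"
  define \<mu> where "\<mu> = l powr (m - 1)"
  have \<mu>: "0 < \<mu>" using l by (simp add: \<mu>_def)
  have sol: "weak_dual_solution_upto G m u0 (\<mu> * T) u"
    using u \<mu> T by (simp add: weak_dual_solution_def)
  note sol = sol[unfolded weak_dual_solution_upto_def]
  have memo: "t \<in> {0<..<T} \<longleftrightarrow> \<mu> * t \<in> {0<..<\<mu> * T}" for t
    using \<mu> by (auto simp: zero_less_mult_iff)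
  have memc: "t \<in> {0..T} \<longleftrightarrow> \<mu> * t \<in> {0..\<mu> * T}" for t
    using \<mu> by (auto simp: zero_le_mult_iff)
  show "weak_dual_solution_upto G m (\<lambda>x. l * u0 x) T (\<lambda>t x. l * u (l powr (m - 1) * t) x)"
    unfolding weak_dual_solution_upto_def \<mu>_def[symmetric]
  proof (intro conjI)
    have "set_borel_measurable lborel ({0<..<T} \<times> UNIV) (\<lambda>(t, x). u (\<mu> * t) x)"
      using sol by (intro set_borel_measurable_scale_fst[OF _ memo]) blast
    then have "(\<lambda>z. l * (indicator ({0<..<T} \<times> UNIV) z *\<^sub>R (case z of (t, x) \<Rightarrow> u (\<mu> * t) x)))
        \<in> borel_measurable lborel"
      unfolding set_borel_measurable_def by (intro borel_measurable_times borel_measurable_const)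
    then show "set_borel_measurable lborel ({0<..<T} \<times> UNIV) (\<lambda>(t, x). l * u (\<mu> * t) x)"
      unfolding set_borel_measurable_def by (simp add: case_prod_unfold mult_ac)
    show "\<forall>t\<in>{0..T}. AE x in lborel. 0 \<le> l * u (\<mu> * t) x"
    proof
      fix t assume "t \<in> {0..T}"
      then have "AE x in lborel. 0 \<le> u (\<mu> * t) x" using sol memc by blast
      then show "AE x in lborel. 0 \<le> l * u (\<mu> * t) x" by (rule eventually_mono) (use l in simp)
    qed
    show "continuous_into_L1 {0..T} (\<lambda>t x. l * u (\<mu> * t) x)"
      unfolding continuous_into_L1_def
    proof (intro ballI conjI)
      fix t assume t: "t \<in> {0..T}"
      have cont: "continuous_into_L1 {0..\<mu> * T} u" using sol by blast
      then show "integrable lborel (\<lambda>x. l * u (\<mu> * t) x)"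
        using t memc unfolding continuous_into_L1_def by auto
      have "filterlim (\<lambda>s. \<mu> * s) (at (\<mu> * t) within {0..\<mu> * T}) (at t within {0..T})"
      proof -
        have "((\<lambda>s. \<mu> * s) \<longlongrightarrow> \<mu> * t) (at t within {0..T})" by (intro tendsto_intros)
        moreover have "\<forall>\<^sub>F s in at t within {0..T}. \<mu> * s \<in> {0..\<mu> * T} \<and> \<mu> * s \<noteq> \<mu> * t"
          using \<mu> memc by (simp add: eventually_at_filter)
        ultimately show ?thesis by (simp add: filterlim_at)
      qed
      moreover have "((\<lambda>s. Lnorm 1 (\<lambda>x. u s x - u (\<mu> * t) x)) \<longlongrightarrow> 0) (at (\<mu> * t) within {0..\<mu> * T})"
        using cont t memc unfolding continuous_into_L1_def by blast
      ultimately have "((\<lambda>s. Lnorm 1 (\<lambda>x. u (\<mu> * s) x - u (\<mu> * t) x)) \<longlongrightarrow> 0) (at t within {0..T})"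
        by (rule filterlim_compose[rotated])
      then have "((\<lambda>s. ennreal l * Lnorm 1 (\<lambda>x. u (\<mu> * s) x - u (\<mu> * t) x)) \<longlongrightarrow> ennreal l * 0) (at t within {0..T})"
        by (rule ennreal_tendsto_cmult[rotated]) simp
      moreover have "\<forall>\<^sub>F s in at t within {0..T}. ennreal l * Lnorm 1 (\<lambda>x. u (\<mu> * s) x - u (\<mu> * t) x)
          = Lnorm 1 (\<lambda>x. l * u (\<mu> * s) x - l * u (\<mu> * t) x)"
      proof -
        have meas: "u (\<mu> * s) \<in> borel_measurable borel" if "s \<in> {0..T}" for s
        proof -
          have "integrable lborel (u (\<mu> * s))"
            using cont that memc unfolding continuous_into_L1_def by blast
          then show ?thesis by (simp add: borel_measurable_integrable)
        qed
        have "ennreal l * Lnorm 1 (\<lambda>x. u (\<mu> * s) x - u (\<mu> * t) x)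
          = Lnorm 1 (\<lambda>x. l * u (\<mu> * s) x - l * u (\<mu> * t) x)" if "s \<in> {0..T}" for s
          using Lnorm_1_cmult[of "\<lambda>x. u (\<mu> * s) x - u (\<mu> * t) x" l] meas[OF that] meas[OF t] l
          by (simp add: right_diff_distrib)
        then show ?thesis by (simp add: eventually_at_filter)
      qed
      ultimately show "((\<lambda>s. Lnorm 1 (\<lambda>x. l * u (\<mu> * s) x - l * u (\<mu> * t) x)) \<longlongrightarrow> 0) (at t within {0..T})"
        using Lim_transform_eventually by fastforce
    qed
    show "\<forall>K. compact K \<longrightarrow> set_integrable lborel ({0<..<T} \<times> K) (\<lambda>(t, x). (l * u (\<mu> * t) x) powr m)"
    proof (intro allI impI)
      fix K :: "'a set" assume "compact K"
      then have "set_integrable lborel ({0<..<\<mu> * T} \<times> K) (\<lambda>(t, x). u t x powr m)"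
        using sol by blast
      then have "set_integrable lborel ({0<..<T} \<times> K) (\<lambda>(t, x). u (\<mu> * t) x powr m)"
        using \<mu> by (intro set_integrable_scale_fst[OF _ _ memo]) auto
      then have "set_integrable lborel ({0<..<T} \<times> K) (\<lambda>z. l powr m * (case z of (t, x) \<Rightarrow> u (\<mu> * t) x powr m))"
        by (rule set_integrable_mult_right)
      then show "set_integrable lborel ({0<..<T} \<times> K) (\<lambda>(t, x). (l * u (\<mu> * t) x) powr m)"
        by (simp add: case_prod_unfold powr_mult)
    qed
    have "AE \<tau> in lborel. case \<tau> of (\<tau>1, \<tau>2) \<Rightarrow> 0 < \<tau>1 \<and> \<tau>1 \<le> \<tau>2 \<and> \<tau>2 \<le> \<mu> * T \<longrightarrow>
         (\<forall>\<psi> \<psi>'. C1c_Linfc \<tau>1 \<tau>2 \<psi> \<psi>' \<longrightarrow> weak_dual_identity G m u \<tau>1 \<tau>2 \<psi> \<psi>')"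
      using sol by blast
    from AE_lborel_scaleR[OF this, of \<mu>] \<mu>
    have "AE \<tau> in lborel. case \<mu> *\<^sub>R \<tau> of (\<tau>1, \<tau>2) \<Rightarrow> 0 < \<tau>1 \<and> \<tau>1 \<le> \<tau>2 \<and> \<tau>2 \<le> \<mu> * T \<longrightarrow>
         (\<forall>\<psi> \<psi>'. C1c_Linfc \<tau>1 \<tau>2 \<psi> \<psi>' \<longrightarrow> weak_dual_identity G m u \<tau>1 \<tau>2 \<psi> \<psi>')"
      by simp
    then show "AE \<tau> in lborel. case \<tau> of (\<tau>1, \<tau>2) \<Rightarrow> 0 < \<tau>1 \<and> \<tau>1 \<le> \<tau>2 \<and> \<tau>2 \<le> T \<longrightarrow>
         (\<forall>\<psi> \<psi>'. C1c_Linfc \<tau>1 \<tau>2 \<psi> \<psi>' \<longrightarrow> weak_dual_identity G m (\<lambda>t x. l * u (\<mu> * t) x) \<tau>1 \<tau>2 \<psi> \<psi>')"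
    proof eventually_elim
      case (elim \<tau>)
      obtain a b where \<tau>: "\<tau> = (a, b)" by fastforce
      show ?case
        unfolding \<tau> prod.case
      proof (intro impI allI)
        fix \<psi> \<psi>' :: "real \<Rightarrow> 'a \<Rightarrow> real"
        assume ab: "0 < a \<and> a \<le> b \<and> b \<le> T" and \<psi>: "C1c_Linfc a b \<psi> \<psi>'"
        have "0 < \<mu> * a \<and> \<mu> * a \<le> \<mu> * b \<and> \<mu> * b \<le> \<mu> * T" using ab \<mu> by simp
        then have "weak_dual_identity G m u (\<mu> * a) (\<mu> * b)
            (\<lambda>t x. \<psi> (1 / \<mu> * t) x) (\<lambda>t x. 1 / \<mu> * \<psi>' (1 / \<mu> * t) x)"
          using elim C1c_Linfc_scale[OF \<psi> \<mu>] by (simp add: \<tau>)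
        then show "weak_dual_identity G m (\<lambda>t x. l * u (\<mu> * t) x) a b \<psi> \<psi>'"
          by (rule weak_dual_identity_scale[OF l \<mu>_def])
      qed
    qed
    show "AE x in lborel. l * u (\<mu> * 0) x = l * u0 x"
      using sol by (auto elim: eventually_mono)
  qed
qed

section \<open>Monotonicity in time and decay of mass\<close>

text \<open>The hypotheses give information for almost every time only; every interval contains a good one.\<close>

lemma AE_real_obtain:
  fixes a b :: real
  assumes "AE t in lborel. P t" "a < b"
  obtains t where "a < t" "t < b" "P t"
proof -
  obtain N where N: "N \<in> null_sets lborel" "{t. \<not> P t} \<subseteq> N"
    using assms(1) by (auto simp: eventually_ae_filter)
  have "\<not> {a<..<b} \<subseteq> N"
  proof
    assume "{a<..<b} \<subseteq> N"
    then have "emeasure lborel {a<..<b} \<le> emeasure lborel N"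
      using N(1) by (intro emeasure_mono) auto
    then show False using N(1) assms(2) by auto
  qed
  then obtain t where t: "t \<in> {a<..<b}" "t \<notin> N" by blast
  show ?thesis
    by (rule that[of t]) (use t N(2) in auto)
qed

lemma continuous_into_L1_near:
  assumes u: "continuous_into_L1 {0..T} u" and t: "0 \<le> t" "t < T" and e: "0 < e"
  shows "\<exists>\<delta>>0. t + \<delta> \<le> T \<and> (\<forall>s. t < s \<and> s < t + \<delta> \<longrightarrow> Lnorm 1 (\<lambda>x. u s x - u t x) < e)"
proof -
  have "((\<lambda>s. Lnorm 1 (\<lambda>x. u s x - u t x)) \<longlongrightarrow> 0) (at t within {0..T})"
    using u t by (simp add: continuous_into_L1_def)
  from order_tendstoD(2)[OF this e] obtain d where d: "0 < d"
    "\<And>s. s \<in> {0..T} \<Longrightarrow> s \<noteq> t \<Longrightarrow> dist s t < d \<Longrightarrow> Lnorm 1 (\<lambda>x. u s x - u t x) < e"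
    unfolding eventually_at by blast
  show ?thesis
  proof (intro exI[of _ "min d (T - t)"] conjI allI impI)
    show "Lnorm 1 (\<lambda>x. u s x - u t x) < e" if "t < s \<and> s < t + min d (T - t)" for s
      using that t by (intro d(2)) (auto simp: dist_real_def)
  qed (use d t in auto)
qed

text \<open>Continuity in \<open>L\<^sup>1\<close> upgrades an inequality from almost every time to every time.\<close>

lemma continuous_into_L1_le:
  fixes u v :: "real \<Rightarrow> 'a::euclidean_space \<Rightarrow> real"
  assumes u: "continuous_into_L1 {0..T} u" and v: "continuous_into_L1 {0..T} v"
    and le: "AE t in lborel. 0 < t \<longrightarrow> (AE x in lborel. u t x \<le> v t x)"
    and t: "0 \<le> t" "t < T"
  shows "AE x in lborel. u t x \<le> v t x"
proof -
  have int: "integrable lborel (u s)" "integrable lborel (v s)" if "s \<in> {0..T}" for s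
    using u v that by (auto simp: continuous_into_L1_def)
  have meas: "u s \<in> borel_measurable borel" "v s \<in> borel_measurable borel" if "s \<in> {0..T}" for s
    using int[OF that, THEN borel_measurable_integrable] by simp_all
  have tT: "t \<in> {0..T}" using t by simp
  note [measurable] = meas[OF tT]
  have le_e: "(\<integral>\<^sup>+x. ennreal (u t x - v t x) \<partial>lborel) \<le> 0 + ennreal e" if e: "0 < e" for e
  proof -
    have e2: "0 < ennreal (e / 2)" using e by simp
    obtain d1 where d1: "0 < d1" "t + d1 \<le> T"
      "\<And>s. t < s \<Longrightarrow> s < t + d1 \<Longrightarrow> Lnorm 1 (\<lambda>x. u s x - u t x) < ennreal (e / 2)"
      using continuous_into_L1_near[OF u t e2] by blast
    obtain d2 where d2: "0 < d2" "t + d2 \<le> T"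
      "\<And>s. t < s \<Longrightarrow> s < t + d2 \<Longrightarrow> Lnorm 1 (\<lambda>x. v s x - v t x) < ennreal (e / 2)"
      using continuous_into_L1_near[OF v t e2] by blast
    obtain s where s: "t < s" "s < t + min d1 d2" "0 < s \<longrightarrow> (AE x in lborel. u s x \<le> v s x)"
      using AE_real_obtain[OF le, of t "t + min d1 d2"] d1(1) d2(1) by auto
    have sT: "s \<in> {0..T}" using s t d1 d2 by auto
    note [measurable] = meas[OF sT]
    have "AE x in lborel. u s x \<le> v s x" using s t by auto
    then have "(\<integral>\<^sup>+x. ennreal (u t x - v t x) \<partial>lborel)
        \<le> (\<integral>\<^sup>+x. ennreal \<bar>u s x - u t x\<bar> + ennreal \<bar>v s x - v t x\<bar> \<partial>lborel)"
    proof (intro nn_integral_mono_AE; elim eventually_mono)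
      fix x assume "u s x \<le> v s x"
      then have "u t x - v t x \<le> \<bar>u s x - u t x\<bar> + \<bar>v s x - v t x\<bar>" by linarith
      then show "ennreal (u t x - v t x) \<le> ennreal \<bar>u s x - u t x\<bar> + ennreal \<bar>v s x - v t x\<bar>"
        by (simp add: ennreal_leI flip: ennreal_plus)
    qed
    also have "\<dots> = Lnorm 1 (\<lambda>x. u s x - u t x) + Lnorm 1 (\<lambda>x. v s x - v t x)"
      by (simp add: Lnorm_1 nn_integral_add)
    also have "\<dots> \<le> ennreal (e / 2) + ennreal (e / 2)"
      using s by (intro add_mono less_imp_le[OF d1(3)] less_imp_le[OF d2(3)]) auto
    also have "\<dots> = 0 + ennreal e" using e by (simp flip: ennreal_plus)
    finally show ?thesis .
  qed
  have "(\<integral>\<^sup>+x. ennreal (u t x - v t x) \<partial>lborel) \<le> 0"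
    by (rule ennreal_le_epsilon) (rule le_e)
  then have "AE x in lborel. ennreal (u t x - v t x) = 0"
    by (simp add: nn_integral_0_iff_AE)
  then show ?thesis by eventually_elim (simp add: ennreal_eq_0_iff)
qed

lemma weak_dual_solutionD:
  assumes "weak_dual_solution G m u0 u"
  shows "0 \<le> t \<Longrightarrow> integrable lborel (u t)"
    and "0 \<le> t \<Longrightarrow> AE x in lborel. 0 \<le> u t x"
    and "0 < T \<Longrightarrow> continuous_into_L1 {0..T} u"
    and "AE x in lborel. u 0 x = u0 x"
    and "0 < T \<Longrightarrow> set_borel_measurable lborel ({0<..<T} \<times> UNIV) (\<lambda>(t, x). u t x)"
proof -
  have sol: "weak_dual_solution_upto G m u0 T u" if "0 < T" for T
    using assms that by (simp add: weak_dual_solution_def)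
  show cont: "continuous_into_L1 {0..T} u" if "0 < T" for T
    using sol[OF that] by (simp add: weak_dual_solution_upto_def)
  show "integrable lborel (u t)" if "0 \<le> t"
    using cont[of "t + 1"] that by (simp add: continuous_into_L1_def)
  show "AE x in lborel. 0 \<le> u t x" if "0 \<le> t"
    using sol[of "t + 1"] that by (simp add: weak_dual_solution_upto_def)
  show "AE x in lborel. u 0 x = u0 x"
    using sol[of 1] by (simp add: weak_dual_solution_upto_def)
  show "set_borel_measurable lborel ({0<..<T} \<times> UNIV) (\<lambda>(t, x). u t x)" if "0 < T"
    using sol[OF that] by (simp add: weak_dual_solution_upto_def)
qed

text \<open>The monotonicity of \<open>t\<^sup>1\<^sup>/\<^sup>(\<^sup>m\<^sup>-\<^sup>1\<^sup>) u(t)\<close> due to Benilan and Crandall: compare \<open>u\<close> with the scaled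
  solution for the factor \<open>l\<close> with \<open>l\<^sup>m\<^sup>-\<^sup>1 = \<tau> / t\<close>.\<close>

lemma time_monotonicity:
  fixes u :: "real \<Rightarrow> 'a::euclidean_space \<Rightarrow> real"
  assumes m: "1 < m" and comparison: "comparison_principle G m"
    and u0: "initial_datum u0" and u: "weak_dual_solution G m u0 u"
    and t: "0 < t" "t \<le> \<tau>"
  shows "AE x in lborel. u t x \<le> (\<tau> / t) powr (1 / (m - 1)) * u \<tau> x"
proof -
  define l where "l = (\<tau> / t) powr (1 / (m - 1))"
  have l: "1 \<le> l" using t m by (simp add: l_def ge_one_powr_ge_zero)
  have lm: "l powr (m - 1) = \<tau> / t" using t m by (simp add: l_def powr_powr)
  define v where "v = (\<lambda>s x. l * u (l powr (m - 1) * s) x)"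
  have v: "weak_dual_solution G m (\<lambda>x. l * u0 x) v"
    unfolding v_def using l by (intro weak_dual_solution_scale[OF u]) simp
  have v0: "initial_datum (\<lambda>x. l * u0 x)"
    using u0 l by (auto simp: initial_datum_def elim: eventually_mono)
  have "AE x in lborel. u0 x \<le> l * u0 x"
    using u0 l unfolding initial_datum_def
    by (auto elim!: eventually_mono intro: mult_right_mono[of 1 l, simplified])
  then have "AE z in lborel. case z of (t, x) \<Rightarrow> 0 < t \<longrightarrow> u t x \<le> v t x"
    using comparison u0 v0 u v unfolding comparison_principle_def by blast
  then have "AE s in lborel. AE x in lborel. 0 < s \<longrightarrow> u s x \<le> v s x"
    unfolding lborel_prod[symmetric] by (drule_tac lborel_pair.AE_pair) simp
  then have "AE s in lborel. 0 < s \<longrightarrow> (AE x in lborel. u s x \<le> v s x)"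
    by (rule eventually_mono) auto
  then have "AE x in lborel. u t x \<le> v t x"
    using t by (intro continuous_into_L1_le[of "t + 1" u v]
        weak_dual_solutionD(3)[OF u] weak_dual_solutionD(3)[OF v]) auto
  then show ?thesis using t lm by (simp add: v_def l_def)
qed

lemma Lnorm_1_triangle:
  assumes [measurable]: "f \<in> borel_measurable borel" "g \<in> borel_measurable borel"
  shows "Lnorm 1 f \<le> Lnorm 1 g + Lnorm 1 (\<lambda>x. f x - g x)"
    and "Lnorm 1 f \<le> Lnorm 1 g + Lnorm 1 (\<lambda>x. g x - f x)"
proof -
  have "ennreal \<bar>f x\<bar> \<le> ennreal \<bar>g x\<bar> + ennreal \<bar>f x - g x\<bar>" for x
    by (simp flip: ennreal_plus)
  then have "Lnorm 1 f \<le> (\<integral>\<^sup>+x. ennreal \<bar>g x\<bar> + ennreal \<bar>f x - g x\<bar> \<partial>lborel)"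
    unfolding Lnorm_1 by (rule nn_integral_mono)
  then show "Lnorm 1 f \<le> Lnorm 1 g + Lnorm 1 (\<lambda>x. f x - g x)"
    by (simp add: Lnorm_1 nn_integral_add)
  then show "Lnorm 1 f \<le> Lnorm 1 g + Lnorm 1 (\<lambda>x. g x - f x)"
    by (simp add: Lnorm_1 abs_minus_commute)
qed

lemma Lp_decayD:
  fixes u :: "real \<Rightarrow> 'a::euclidean_space \<Rightarrow> real"
  assumes decay: "Lp_decay G m" and u0: "initial_datum u0" and u: "weak_dual_solution G m u0 u"
    and r: "1 \<le> r"
  shows "AE \<tau>1 in lborel. AE \<tau>2 in lborel. 0 \<le> \<tau>1 \<and> \<tau>1 \<le> \<tau>2 \<longrightarrow> Lnorm r (u \<tau>2) \<le> Lnorm r (u \<tau>1)"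
proof -
  have "\<forall>r\<ge>1. AE \<tau> in lborel. case \<tau> of (\<tau>1, \<tau>2) \<Rightarrow> 0 \<le> \<tau>1 \<and> \<tau>1 \<le> \<tau>2 \<longrightarrow> Lnorm r (u \<tau>2) \<le> Lnorm r (u \<tau>1)"
    using decay u0 u unfolding Lp_decay_def by blast
  then have "AE \<tau> in lborel \<Otimes>\<^sub>M lborel. case \<tau> of (\<tau>1, \<tau>2) \<Rightarrow> 0 \<le> \<tau>1 \<and> \<tau>1 \<le> \<tau>2 \<longrightarrow> Lnorm r (u \<tau>2) \<le> Lnorm r (u \<tau>1)"
    using r by (simp only: lborel_prod)
  from lborel_pair.AE_pair[OF this] show ?thesis by simp
qed

text \<open>The decay hypothesis says nothing about \<open>\<tau>\<^sub>1 = 0\<close>, nor about a given \<open>t\<close>; both are approached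
  through good times, using continuity in \<open>L\<^sup>1\<close>.\<close>

lemma mass_decay:
  fixes u :: "real \<Rightarrow> 'a::euclidean_space \<Rightarrow> real"
  assumes decay: "Lp_decay G m" and u0: "initial_datum u0" and u: "weak_dual_solution G m u0 u"
    and t: "0 \<le> t"
  shows "Lnorm 1 (u t) \<le> Lnorm 1 u0"
proof -
  have meas: "u s \<in> borel_measurable borel" if "0 \<le> s" for s
    using weak_dual_solutionD(1)[OF u that, THEN borel_measurable_integrable] by simp
  have AE: "AE \<tau>1 in lborel. AE \<tau>2 in lborel. 0 \<le> \<tau>1 \<and> \<tau>1 \<le> \<tau>2 \<longrightarrow> Lnorm 1 (u \<tau>2) \<le> Lnorm 1 (u \<tau>1)"
    by (rule Lp_decayD[OF decay u0 u]) simp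
  have cont: "continuous_into_L1 {0..t + 1} u"
    using t by (intro weak_dual_solutionD(3)[OF u]) simp
  have le_e: "Lnorm 1 (u t) \<le> Lnorm 1 (u 0) + ennreal e" if e: "0 < e" for e
  proof -
    have e2: "0 < ennreal (e / 2)" using e by simp
    have "0 < t + 1" "t < t + 1" using t by auto
    obtain d1 where d1: "0 < d1" "0 + d1 \<le> t + 1"
      "\<And>s. 0 < s \<Longrightarrow> s < 0 + d1 \<Longrightarrow> Lnorm 1 (\<lambda>x. u s x - u 0 x) < ennreal (e / 2)"
      using continuous_into_L1_near[OF cont order_refl \<open>0 < t + 1\<close> e2] by blast
    obtain d2 where d2: "0 < d2" "t + d2 \<le> t + 1"
      "\<And>s. t < s \<Longrightarrow> s < t + d2 \<Longrightarrow> Lnorm 1 (\<lambda>x. u s x - u t x) < ennreal (e / 2)"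
      using continuous_into_L1_near[OF cont t \<open>t < t + 1\<close> e2] by blast
    have "0 < min d1 d2" using d1(1) d2(1) by simp
    from AE_real_obtain[OF AE this] obtain \<tau>1 where \<tau>1: "0 < \<tau>1" "\<tau>1 < min d1 d2"
      "AE \<tau>2 in lborel. 0 \<le> \<tau>1 \<and> \<tau>1 \<le> \<tau>2 \<longrightarrow> Lnorm 1 (u \<tau>2) \<le> Lnorm 1 (u \<tau>1)"
      by blast
    have "t + \<tau>1 < t + d2" using \<tau>1 by simp
    from AE_real_obtain[OF \<tau>1(3) this] obtain \<tau>2 where \<tau>2: "t + \<tau>1 < \<tau>2" "\<tau>2 < t + d2"
      "0 \<le> \<tau>1 \<and> \<tau>1 \<le> \<tau>2 \<longrightarrow> Lnorm 1 (u \<tau>2) \<le> Lnorm 1 (u \<tau>1)"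
      by blast
    have *: "Lnorm 1 (u \<tau>1) \<le> Lnorm 1 (u 0) + ennreal (e / 2)"
    proof -
      have "Lnorm 1 (u \<tau>1) \<le> Lnorm 1 (u 0) + Lnorm 1 (\<lambda>x. u \<tau>1 x - u 0 x)"
        using \<tau>1 by (intro Lnorm_1_triangle meas) auto
      also have "\<dots> \<le> Lnorm 1 (u 0) + ennreal (e / 2)"
        using \<tau>1 by (intro add_left_mono less_imp_le[OF d1(3)]) auto
      finally show ?thesis .
    qed
    have "Lnorm 1 (u t) \<le> Lnorm 1 (u \<tau>2) + Lnorm 1 (\<lambda>x. u \<tau>2 x - u t x)"
      using t \<tau>1 \<tau>2 by (intro Lnorm_1_triangle meas) auto
    also have "\<dots> \<le> Lnorm 1 (u \<tau>1) + ennreal (e / 2)"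
      using t \<tau>1 \<tau>2 by (intro add_mono less_imp_le[OF d2(3)]) auto
    also have "\<dots> \<le> Lnorm 1 (u 0) + ennreal (e / 2) + ennreal (e / 2)"
      using * by (rule add_right_mono)
    also have "\<dots> = Lnorm 1 (u 0) + ennreal e"
      using e by (simp add: add.assoc ennreal_plus[symmetric] del: ennreal_plus)
    finally show ?thesis .
  qed
  have "Lnorm 1 (u t) \<le> Lnorm 1 (u 0)"
    by (rule ennreal_le_epsilon) (rule le_e)
  also have "Lnorm 1 (u 0) = Lnorm 1 u0"
    unfolding Lnorm_1 using weak_dual_solutionD(4)[OF u]
    by (intro nn_integral_cong_AE) (auto elim: eventually_mono)
  finally show ?thesis .
qed

section \<open>The identity for the time integral of the power\<close>

lemma AE_eq_of_bounded_integrals: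
  fixes f g :: "'a::euclidean_space \<Rightarrow> ennreal"
  assumes [measurable]: "f \<in> borel_measurable borel" "g \<in> borel_measurable borel"
    and eq: "\<And>B. B \<in> sets borel \<Longrightarrow> bounded B \<Longrightarrow>
      (\<integral>\<^sup>+x. f x * indicator B x \<partial>lborel) = (\<integral>\<^sup>+x. g x * indicator B x \<partial>lborel)"
  shows "AE x in lborel. f x = g x"
proof -
  have "emeasure (density lborel f) A = emeasure (density lborel g) A" if A: "A \<in> sets lborel" for A
  proof -
    have [measurable]: "A \<in> sets borel" using A by simp
    have UN: "(\<Union>n::nat. A \<inter> ball 0 (real n)) = A"
      by (auto simp: reals_Archimedean2)
    have inc: "incseq (\<lambda>n::nat. A \<inter> ball 0 (real n))"
      by (auto simp: incseq_def)
    have lim: "(SUP n. emeasure (density lborel h) (A \<inter> ball 0 (real n))) = emeasure (density lborel h) A"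
      for h :: "'a \<Rightarrow> ennreal"
    proof -
      have "range (\<lambda>n::nat. A \<inter> ball 0 (real n)) \<subseteq> sets (density lborel h)" by auto
      from SUP_emeasure_incseq[OF this inc] show ?thesis unfolding UN .
    qed
    have "emeasure (density lborel f) (A \<inter> ball 0 (real n)) = emeasure (density lborel g) (A \<inter> ball 0 (real n))"
      for n
      using eq[of "A \<inter> ball 0 (real n)"] by (simp add: emeasure_density bounded_Int)
    then show ?thesis using lim[of f] lim[of g] by simp
  qed
  then have "density lborel f = density lborel g"
    by (intro measure_eqI) auto
  then show ?thesis by (intro sigma_finite_measure.density_unique[OF lborel.sigma_finite_measure_axioms]) auto
qed

text \<open>If the convolution is infinite, both sides are zero by convention.\<close>

lemma green_inverse_eq_conv:
  fixes G :: "'a::euclidean_space \<Rightarrow> 'a \<Rightarrow> real"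
  assumes [measurable]: "k \<in> borel_measurable borel" "f \<in> borel_measurable borel"
    "G 0 \<in> borel_measurable borel"
    and even: "\<And>z. k (- z) = k z" and pos: "\<And>z. 0 \<le> k z"
    and G: "AE z in lborel. G 0 z = k z"
    and f: "AE x in lborel. 0 \<le> f x"
  shows "green_inverse G f y = enn2real (conv k (\<lambda>x. ennreal (f x)) y)"
proof -
  have shift: "AE x in lborel. G 0 (x - y) = k (x - y)"
  proof -
    obtain N where N: "N \<in> null_sets lborel" "{z. G 0 z \<noteq> k z} \<subseteq> N"
      using G by (auto simp: eventually_ae_filter)
    have [measurable]: "N \<in> sets borel" using N(1) by auto
    have "(\<integral>\<^sup>+x. indicator N (x - y) \<partial>lborel) = 0"
      using N(1) by (subst nn_integral_lborel_diff(1)) auto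
    then have "AE x in lborel. x - y \<notin> N"
      by (subst (asm) nn_integral_0_iff_AE) (auto simp: indicator_def)
    then show ?thesis by (rule eventually_mono) (use N(2) in auto)
  qed
  have "green_inverse G f y = (\<integral>x. G 0 (x - y) * f x \<partial>lborel)"
    by (simp add: green_inverse_def)
  also have "\<dots> = enn2real (\<integral>\<^sup>+x. ennreal (k (x - y) * f x) \<partial>lborel)"
  proof -
    have "(\<integral>x. G 0 (x - y) * f x \<partial>lborel) = (\<integral>x. k (x - y) * f x \<partial>lborel)"
      using shift by (intro integral_cong_AE) (auto elim: eventually_mono)
    also have "\<dots> = enn2real (\<integral>\<^sup>+x. ennreal (k (x - y) * f x) \<partial>lborel)"
      using f pos by (intro integral_eq_nn_integral) (auto elim!: eventually_mono)
    finally show ?thesis .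
  qed
  also have "(\<integral>\<^sup>+x. ennreal (k (x - y) * f x) \<partial>lborel) = conv k (\<lambda>x. ennreal (f x)) y"
  proof -
    have "k (y - x) = k (x - y)" for x using even[of "x - y"] by simp
    then show ?thesis unfolding conv_def by (simp only: ennreal_mult'[OF pos])
  qed
  finally show ?thesis .
qed

lemma C1c_Linfc_indicator:
  fixes B :: "'a::euclidean_space set"
  assumes [measurable]: "B \<in> sets borel" and B: "bounded B"
  shows "C1c_Linfc a b (\<lambda>t. indicator B) (\<lambda>t x. 0)"
proof -
  have "esssup lborel (\<lambda>x::'a. 0 :: ennreal) \<le> 0"
    by (rule esssup_I) auto
  then have zero: "Lnorm \<infinity> (\<lambda>x::'a. 0 :: real) = 0" by (simp add: Lnorm_def)
  have "Lnorm \<infinity> (indicator B :: 'a \<Rightarrow> real) \<le> 1"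
    unfolding Lnorm_def by (auto intro!: esssup_I simp: indicator_def)
  then have one: "Lnorm \<infinity> (indicator B :: 'a \<Rightarrow> real) < \<infinity>"
    by (simp add: order_le_less_trans[of _ 1])
  have "(\<lambda>z::real \<times> 'a. indicator ({a..b} \<times> UNIV) z *\<^sub>R (indicator B (snd z) :: real))
      \<in> borel_measurable borel"
  proof -
    have "(\<lambda>z::real \<times> 'a. indicator {a..b} (fst z) * (indicator B (snd z) :: real))
      \<in> borel_measurable (borel \<Otimes>\<^sub>M borel)" by measurable
    then show ?thesis by (simp add: borel_prod indicator_times)
  qed
  then show ?thesis
    unfolding C1c_Linfc_def set_borel_measurable_def
    using B one
    by (auto simp: zero[unfolded infinity_ennreal_def] case_prod_unfold Linfc_def intro!: exI[of _ "closure B"] AE_I2)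
       (auto simp: indicator_def dest: closure_subset[THEN subsetD])
qed

text \<open>The function \<open>F(x) = \<integral> u(t, x)\<^sup>m dt\<close> with \<open>t\<close> in \<open>[a, b]\<close>, with values in \<open>[0,\<infinity>]\<close>. As an extended
  nonnegative integral it is defined without knowing that \<open>u\<^sup>m\<close> is integrable.\<close>

definition time_power_integral ::
  "real \<Rightarrow> (real \<Rightarrow> 'a::euclidean_space \<Rightarrow> real) \<Rightarrow> real \<Rightarrow> real \<Rightarrow> 'a \<Rightarrow> ennreal" where
  "time_power_integral m u a b x = (\<integral>\<^sup>+t. indicator {a..b} t * ennreal (u t x powr m) \<partial>lborel)"

lemma borel_measurable_time_power_integral:
  fixes u :: "real \<Rightarrow> 'a::euclidean_space \<Rightarrow> real"
  assumes "(\<lambda>z. indicator {a..b} (fst z) * ennreal (u (fst z) (snd z) powr m)) \<in> borel_measurable borel"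
  shows "time_power_integral m u a b \<in> borel_measurable borel"
proof -
  have "(\<lambda>z. indicator {a..b} (fst z) * ennreal (u (fst z) (snd z) powr m))
      \<in> borel_measurable (borel \<Otimes>\<^sub>M borel)"
    using assms by (simp add: borel_prod)
  from measurable_compose[OF measurable_pair_swap' this]
  have "(\<lambda>(x, t). indicator {a..b} t * ennreal (u t x powr m)) \<in> borel_measurable (borel \<Otimes>\<^sub>M lborel)"
    by (simp add: case_prod_unfold)
  then show ?thesis
    unfolding time_power_integral_def[abs_def] by (intro lborel.borel_measurable_nn_integral)
qed

text \<open>The weak identity is tested with indicator functions of bounded Borel sets, constant in time.
  The convergence of its integrals makes the four terms finite on bounded sets, so that the
  differences in it may be rearranged into sums of extended nonnegative integrals.\<close>

lemma potential_identity:
  fixes G :: "'a::euclidean_space \<Rightarrow> 'a \<Rightarrow> real" and u :: "real \<Rightarrow> 'a \<Rightarrow> real"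
    and t1 t2 m :: real
  defines "F \<equiv> time_power_integral m u t1 t2"
  assumes k [measurable]: "k \<in> borel_measurable borel"
    and even: "\<And>z. k (- z) = k z" and pos: "\<And>z. 0 \<le> k z"
    and k1: "(\<integral>\<^sup>+z. ennreal (k z) \<partial>lborel) < \<infinity>"
    and G [measurable]: "G 0 \<in> borel_measurable borel" and Gk: "AE z in lborel. G 0 z = k z"
    and u1: "integrable lborel (u t1)" "AE x in lborel. 0 \<le> u t1 x"
    and u2: "integrable lborel (u t2)" "AE x in lborel. 0 \<le> u t2 x"
    and um: "(\<lambda>z. indicator {t1..t2} (fst z) * ennreal (u (fst z) (snd z) powr m)) \<in> borel_measurable borel"
    and id: "\<And>\<psi> \<psi>'. C1c_Linfc t1 t2 \<psi> \<psi>' \<Longrightarrow> weak_dual_identity G m u t1 t2 \<psi> \<psi>'"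
  shows "AE x in lborel. F x + conv k (\<lambda>y. ennreal (u t2 y)) x = conv k F x + conv k (\<lambda>y. ennreal (u t1 y)) x"
proof (rule AE_eq_of_bounded_integrals)
  have [measurable]: "u t1 \<in> borel_measurable borel" "u t2 \<in> borel_measurable borel"
    using u1(1) u2(1) by (auto dest: borel_measurable_integrable)
  have um' [measurable]: "(\<lambda>z. indicator {t1..t2} (fst z) * ennreal (u (fst z) (snd z) powr m))
      \<in> borel_measurable (borel \<Otimes>\<^sub>M borel)"
    using um by (simp add: borel_prod)
  have F [measurable]: "F \<in> borel_measurable borel"
    unfolding F_def by (rule borel_measurable_time_power_integral[OF um])
  show "(\<lambda>x. F x + conv k (\<lambda>y. ennreal (u t2 y)) x) \<in> borel_measurable borel"
    "(\<lambda>x. conv k F x + conv k (\<lambda>y. ennreal (u t1 y)) x) \<in> borel_measurable borel"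
    by measurable
  fix B :: "'a set" assume [measurable]: "B \<in> sets borel" and B: "bounded B"
  have wdi: "weak_dual_identity G m u t1 t2 (\<lambda>t. indicator B) (\<lambda>t x. 0)"
    by (intro id C1c_Linfc_indicator B) simp
  note wdi = wdi[unfolded weak_dual_identity_def]
  define g where "g x = green_inverse G (indicator B) x" for x
  have g: "ennreal (g x) = conv k (indicator B) x" for x
  proof -
    have "conv k (indicator B) x \<le> conv k (\<lambda>_. 1) x"
      by (rule conv_mono_AE) (simp add: indicator_def)
    also have "\<dots> < top" using k1 by (simp add: conv_const)
    finally have "conv k (indicator B) x < top" .
    moreover have "g x = enn2real (conv k (\<lambda>x. ennreal (indicator B x)) x)"
      unfolding g_def by (intro green_inverse_eq_conv even pos Gk G) auto
    ultimately show ?thesis by (simp add: ennreal_indicator)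
  qed
  have g0: "0 \<le> g x" for x
  proof -
    have "g x = enn2real (conv k (\<lambda>x. ennreal (indicator B x)) x)"
      unfolding g_def by (intro green_inverse_eq_conv even pos Gk G) auto
    then show ?thesis by simp
  qed
  have slice: "(\<integral>\<^sup>+z. ennreal (indicator ({t1..t2} \<times> UNIV) z *\<^sub>R (case z of (t, x) \<Rightarrow> u t x powr m * h x)) \<partial>lborel)
      = (\<integral>\<^sup>+x. F x * ennreal (h x) \<partial>lborel)"
    if h: "\<And>x. 0 \<le> h x" and [measurable]: "h \<in> borel_measurable borel" for h
  proof -
    have "(\<integral>\<^sup>+z. ennreal (indicator ({t1..t2} \<times> UNIV) z *\<^sub>R (case z of (t, x) \<Rightarrow> u t x powr m * h x)) \<partial>lborel)
       = (\<integral>\<^sup>+z. indicator {t1..t2} (fst z) * ennreal (u (fst z) (snd z) powr m) * ennreal (h (snd z)) \<partial>(lborel \<Otimes>\<^sub>M lborel))"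
      unfolding lborel_prod using h
      by (intro nn_integral_cong) (auto simp: indicator_def ennreal_mult split: prod.splits)
    also have "\<dots> = (\<integral>\<^sup>+x. \<integral>\<^sup>+t. indicator {t1..t2} t * ennreal (u t x powr m) * ennreal (h x) \<partial>lborel \<partial>lborel)"
      by (subst lborel_pair.nn_integral_snd[symmetric]) (simp_all add: case_prod_unfold)
    also have "\<dots> = (\<integral>\<^sup>+x. F x * ennreal (h x) \<partial>lborel)"
    proof -
      have "(\<lambda>t. indicator {t1..t2} t * ennreal (u t x powr m)) \<in> borel_measurable lborel" for x
        using measurable_compose[OF measurable_Pair2' um'] by simp
      then show ?thesis by (simp add: nn_integral_multc F_def time_power_integral_def)
    qed
    finally show ?thesis .
  qed
  define \<alpha> where "\<alpha> = (\<lambda>z. indicator ({t1..t2} \<times> UNIV) z *\<^sub>R (case z of (t, x) \<Rightarrow> u t x powr m * (indicator B x :: real)))"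
  define \<beta> where "\<beta> = (\<lambda>z. indicator ({t1..t2} \<times> UNIV) z *\<^sub>R (case z of (t, x) \<Rightarrow> u t x powr m * g x))"
  have \<alpha>: "integrable lborel \<alpha>" and \<beta>: "integrable lborel \<beta>"
    using wdi by (auto simp: set_integrable_def \<alpha>_def \<beta>_def g_def)
  have [measurable]: "g \<in> borel_measurable borel"
  proof -
    have "g = (\<lambda>x. enn2real (conv k (indicator B) x))"
      by (rule ext) (simp add: g[symmetric] g0)
    then show ?thesis by simp
  qed
  have A: "ennreal (\<integral>z. \<alpha> z \<partial>lborel) = (\<integral>\<^sup>+x. F x * indicator B x \<partial>lborel)"
    using slice[of "indicator B"] nn_integral_eq_integral[OF \<alpha>]
    by (simp add: \<alpha>_def split_beta ennreal_indicator)
  have B': "ennreal (\<integral>z. \<beta> z \<partial>lborel) = (\<integral>\<^sup>+x. conv k F x * indicator B x \<partial>lborel)"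
    using slice[of g] nn_integral_eq_integral[OF \<beta>] g0
    by (simp add: \<beta>_def split_beta g conv_commute[OF k F _ even])
  have pot: "ennreal (\<integral>x. green_inverse G (u t) x * indicator B x \<partial>lborel)
      = (\<integral>\<^sup>+x. conv k (\<lambda>y. ennreal (u t y)) x * indicator B x \<partial>lborel)
      \<and> 0 \<le> (\<integral>x. green_inverse G (u t) x * indicator B x \<partial>lborel)"
    if ut: "integrable lborel (u t)" "AE x in lborel. 0 \<le> u t x"
      and int: "integrable lborel (\<lambda>x. green_inverse G (u t) x * indicator B x)" for t
  proof
    have [measurable]: "u t \<in> borel_measurable borel" using ut(1) by (auto dest: borel_measurable_integrable)
    have eq: "green_inverse G (u t) x = enn2real (conv k (\<lambda>x. ennreal (u t x)) x)" for x
      using ut by (intro green_inverse_eq_conv even pos Gk G) auto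
    have "(\<integral>\<^sup>+x. ennreal (u t x) \<partial>lborel) \<le> (\<integral>\<^sup>+x. ennreal (norm (u t x)) \<partial>lborel)"
      by (intro nn_integral_mono ennreal_leI) simp
    also have "\<dots> < \<infinity>"
      using ut(1) by (simp add: integrable_iff_bounded)
    finally have "(\<integral>\<^sup>+x. ennreal (u t x) \<partial>lborel) < \<infinity>" .
    then have "(\<integral>\<^sup>+x. conv k (\<lambda>x. ennreal (u t x)) x \<partial>lborel) \<noteq> \<infinity>"
      using k1 by (simp add: nn_integral_conv ennreal_mult_eq_top_iff less_top)
    then have fin: "AE x in lborel. conv k (\<lambda>x. ennreal (u t x)) x \<noteq> \<infinity>"
      by (intro nn_integral_noteq_infinite) auto
    have "ennreal (\<integral>x. green_inverse G (u t) x * indicator B x \<partial>lborel)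
        = (\<integral>\<^sup>+x. ennreal (green_inverse G (u t) x * indicator B x) \<partial>lborel)"
      by (intro nn_integral_eq_integral[symmetric] int) (auto simp: eq)
    also have "\<dots> = (\<integral>\<^sup>+x. conv k (\<lambda>y. ennreal (u t y)) x * indicator B x \<partial>lborel)"
      using fin by (intro nn_integral_cong_AE)
        (auto elim!: eventually_mono simp: eq indicator_def less_top)
    finally show "ennreal (\<integral>x. green_inverse G (u t) x * indicator B x \<partial>lborel)
      = (\<integral>\<^sup>+x. conv k (\<lambda>y. ennreal (u t y)) x * indicator B x \<partial>lborel)" .
    show "0 \<le> (\<integral>x. green_inverse G (u t) x * indicator B x \<partial>lborel)"
      by (intro integral_nonneg_AE) (auto simp: eq)
  qed
  have i1: "integrable lborel (\<lambda>x. green_inverse G (u t1) x * indicator B x)"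
    and i2: "integrable lborel (\<lambda>x. green_inverse G (u t2) x * indicator B x)"
    using wdi by auto
  have "(LINT t:{t1..t2}|lborel. (\<integral>x. green_inverse G (u t) x * 0 - u t x powr m * indicator B x
          + u t x powr m * g x \<partial>lborel)) = (\<integral>z. \<beta> z \<partial>lborel) - (\<integral>z. \<alpha> z \<partial>lborel)" (is "?L = _")
  proof -
    have int: "integrable (lborel \<Otimes>\<^sub>M lborel) (\<lambda>z. \<beta> z - \<alpha> z)"
      unfolding lborel_prod by (intro Bochner_Integration.integrable_diff \<alpha> \<beta>)
    have "?L = (\<integral>t. \<integral>x. \<beta> (t, x) - \<alpha> (t, x) \<partial>lborel \<partial>lborel)"
      unfolding set_lebesgue_integral_def
      by (intro Bochner_Integration.integral_cong refl) (auto simp: \<alpha>_def \<beta>_def indicator_def)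
    also have "\<dots> = (\<integral>z. \<beta> z - \<alpha> z \<partial>lborel)"
      using lborel_pair.integral_fst'[OF int] by (simp add: lborel_prod)
    finally show ?thesis by (simp add: \<alpha> \<beta>)
  qed
  then have eq: "(\<integral>z. \<alpha> z \<partial>lborel) + (\<integral>x. green_inverse G (u t2) x * indicator B x \<partial>lborel)
      = (\<integral>z. \<beta> z \<partial>lborel) + (\<integral>x. green_inverse G (u t1) x * indicator B x \<partial>lborel)"
    using wdi by (simp add: g_def)
  have "0 \<le> (\<integral>z. \<alpha> z \<partial>lborel)" "0 \<le> (\<integral>z. \<beta> z \<partial>lborel)"
    using g0 by (auto intro!: integral_nonneg_AE AE_I2 simp: \<alpha>_def \<beta>_def)
  then have "ennreal (\<integral>z. \<alpha> z \<partial>lborel) + ennreal (\<integral>x. green_inverse G (u t2) x * indicator B x \<partial>lborel)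
      = ennreal (\<integral>z. \<beta> z \<partial>lborel) + ennreal (\<integral>x. green_inverse G (u t1) x * indicator B x \<partial>lborel)"
    using pot[OF u1 i1, THEN conjunct2] pot[OF u2 i2, THEN conjunct2] eq
    by (simp only: ennreal_plus[symmetric])
  then show "(\<integral>\<^sup>+x. (F x + conv k (\<lambda>y. ennreal (u t2 y)) x) * indicator B x \<partial>lborel)
      = (\<integral>\<^sup>+x. (conv k F x + conv k (\<lambda>y. ennreal (u t1 y)) x) * indicator B x \<partial>lborel)"
    using pot[OF u1 i1] pot[OF u2 i2] by (simp add: A B' distrib_right nn_integral_add)
qed

section \<open>The smoothing estimate\<close>

text \<open>If \<open>U\<close> exceeds the first term of the maximum, then the factors \<open>U\<^sup>m\<close> cancel in the main inequality
  up to a power \<open>U\<^sup>1\<^sup>-\<^sup>1\<^sup>/\<^sup>p\<close>, which leaves the second term as a bound.\<close>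

lemma smoothing_arithmetic:
  fixes m p t t2 U M C :: real
  assumes m: "1 < m" and p: "1 < p" and M: "0 < M" and C: "0 < C" and t: "0 < t"
    and t2: "m * t \<le> t2" "t2 \<le> (1 + m) * t" and U: "0 < U"
    and main: "(t2 - t) * (t / t2) powr (m / (m - 1)) * U powr m
      \<le> C * ((t2 - t) * U powr m) powr (1 / p) * ((t2 - t) * U powr (m - 1) * M) powr (1 - 1 / p)
        + C * U powr (1 / p) * M powr (1 - 1 / p)"
  shows "U \<le> max (((m - 1) * t) powr (- 1 / (m - 1)))
    ((2 * (1 + m) powr (m / (m - 1)) * C) powr (p / (p - 1)) * M)"
proof (cases "U \<le> ((m - 1) * t) powr (- 1 / (m - 1))")
  case False
  define D where "D = t2 - t"
  define \<alpha> where "\<alpha> = m / (m - 1)"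
  define X where "X = U powr (m - 1 + 1 / p)"
  have mt: "0 < (m - 1) * t" using m t by simp
  have D: "(m - 1) * t \<le> D" using t2 by (simp add: D_def algebra_simps)
  have D0: "0 < D" using D mt by linarith
  have t20: "0 < t2" using D0 t by (simp add: D_def)
  have X: "0 < X" using U by (simp add: X_def)
  have \<alpha>: "0 < \<alpha>" using m by (simp add: \<alpha>_def)
  \<comment> \<open>In this regime the term without time integral is dominated by the other one.\<close>
  have "1 / ((m - 1) * t) = (((m - 1) * t) powr (- 1 / (m - 1))) powr (m - 1)"
  proof -
    have "- 1 / (m - 1) * (m - 1) = - 1" using m by simp
    then show ?thesis using mt by (simp only: powr_powr powr_neg_one)
  qed
  also have "\<dots> \<le> U powr (m - 1)"
    using False m by (intro powr_mono2) auto
  finally have "1 \<le> (m - 1) * t * U powr (m - 1)"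
    using mt by (simp add: field_simps)
  also have "\<dots> \<le> D * U powr (m - 1)"
    using D by (rule mult_right_mono) simp
  finally have "U powr (1 / p) \<le> D * U powr (m - 1) * U powr (1 / p)"
    by (simp add: mult_le_cancel_right1)
  then have UX: "U powr (1 / p) \<le> D * X"
    by (simp add: X_def powr_add)
  have first: "(D * U powr m) powr (1 / p) * (D * U powr (m - 1) * M) powr (1 - 1 / p)
      = D * X * M powr (1 - 1 / p)"
  proof -
    have "m / p + (m - 1) * (1 - 1 / p) = m - 1 + 1 / p"
      using p by (simp add: field_simps)
    then have "U powr (m / p) * U powr ((m - 1) * (1 - 1 / p)) = X"
      by (simp add: X_def powr_add[symmetric])
    moreover have "D powr (1 / p) * D powr (1 - 1 / p) = D"
      using D0 by (simp add: powr_add[symmetric])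
    ultimately show ?thesis
      by (simp add: powr_mult powr_powr mult_ac)
  qed
  have Um: "U powr m = X * U powr (1 - 1 / p)"
    by (simp add: X_def powr_add[symmetric])
  have "D * (t / t2) powr \<alpha> * U powr m \<le> C * (D * X * M powr (1 - 1 / p)) + C * (D * X) * M powr (1 - 1 / p)"
  proof -
    have "D * (t / t2) powr \<alpha> * U powr m \<le> C * (D * X * M powr (1 - 1 / p)) + C * U powr (1 / p) * M powr (1 - 1 / p)"
      using main unfolding D_def[symmetric] \<alpha>_def[symmetric] first[symmetric] by (simp only: mult.assoc)
    also have "C * U powr (1 / p) * M powr (1 - 1 / p) \<le> C * (D * X) * M powr (1 - 1 / p)"
      using UX C by (intro mult_right_mono mult_left_mono) auto
    finally show ?thesis by simp
  qed
  then have "(D * X) * ((t / t2) powr \<alpha> * U powr (1 - 1 / p)) \<le> (D * X) * (2 * C * M powr (1 - 1 / p))"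
    by (simp add: Um algebra_simps)
  then have "(t / t2) powr \<alpha> * U powr (1 - 1 / p) \<le> 2 * C * M powr (1 - 1 / p)"
    using D0 X by (simp add: mult_le_cancel_left_pos)
  then have *: "U powr (1 - 1 / p) \<le> (t2 / t) powr \<alpha> * (2 * C * M powr (1 - 1 / p))"
    using t t20 by (simp add: powr_divide field_simps)
  have "(t2 / t) powr \<alpha> \<le> (1 + m) powr \<alpha>"
    using t t2 t20 \<alpha> by (intro powr_mono2) (auto simp: field_simps)
  then have "(t2 / t) powr \<alpha> * (2 * C * M powr (1 - 1 / p)) \<le> (1 + m) powr \<alpha> * (2 * C * M powr (1 - 1 / p))"
    using C by (intro mult_right_mono) auto
  with * have "U powr (1 - 1 / p) \<le> (2 * (1 + m) powr \<alpha> * C) * M powr (1 - 1 / p)"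
    by (simp add: mult_ac)
  then have "(U powr (1 - 1 / p)) powr (p / (p - 1)) \<le> ((2 * (1 + m) powr \<alpha> * C) * M powr (1 - 1 / p)) powr (p / (p - 1))"
    using p by (intro powr_mono2) auto
  moreover
  have e: "(1 - 1 / p) * (p / (p - 1)) = 1" using p by (simp add: field_simps)
  have "(U powr (1 - 1 / p)) powr (p / (p - 1)) = U"
    "(M powr (1 - 1 / p)) powr (p / (p - 1)) = M"
    using U M by (simp_all only: powr_powr e powr_one less_imp_le)
  ultimately have "U \<le> (2 * (1 + m) powr \<alpha> * C) powr (p / (p - 1)) * M"
    by (simp only: powr_mult)
  then show ?thesis by (simp add: \<alpha>_def)
qed simp

lemma nn_integral_mono_AE_swap:
  fixes f g :: "real \<Rightarrow> 'a::euclidean_space \<Rightarrow> ennreal"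
  assumes f: "(\<lambda>z. f (fst z) (snd z)) \<in> borel_measurable borel"
    and g: "(\<lambda>z. g (fst z) (snd z)) \<in> borel_measurable borel"
    and le: "AE t in lborel. AE x in lborel. f t x \<le> g t x"
  shows "AE x in lborel. (\<integral>\<^sup>+t. f t x \<partial>lborel) \<le> (\<integral>\<^sup>+t. g t x \<partial>lborel)"
proof -
  have [measurable]: "(\<lambda>z. f (fst z) (snd z)) \<in> borel_measurable (lborel \<Otimes>\<^sub>M lborel)"
    "(\<lambda>z. g (fst z) (snd z)) \<in> borel_measurable (lborel \<Otimes>\<^sub>M lborel)"
    using f g by (simp_all add: lborel_prod)
  have "AE x in lborel. AE t in lborel. f t x \<le> g t x"
  proof (subst lborel_pair.AE_commute[symmetric])
    have "Measurable.pred (lborel \<Otimes>\<^sub>M lborel) (\<lambda>z. f (fst z) (snd z) \<le> g (fst z) (snd z))"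
      by measurable
    then show "{z \<in> space (lborel \<Otimes>\<^sub>M lborel). f (fst z) (snd z) \<le> g (fst z) (snd z)} \<in> sets (lborel \<Otimes>\<^sub>M lborel)"
      unfolding pred_def .
  qed (rule le)
  then show ?thesis
    by (rule eventually_mono) (rule nn_integral_mono_AE)
qed

lemma borel_measurable_indicator_times_fst_snd:
  fixes f :: "'a::euclidean_space \<Rightarrow> ennreal"
  assumes "f \<in> borel_measurable borel" "S \<in> sets borel"
  shows "(\<lambda>z :: real \<times> 'a. indicator S (fst z) * f (snd z)) \<in> borel_measurable borel"
proof -
  note [measurable] = assms
  have "(\<lambda>z :: real \<times> 'a. indicator S (fst z) * f (snd z)) \<in> borel_measurable (borel \<Otimes>\<^sub>M borel)"
    by measurable
  then show ?thesis by (simp add: borel_prod)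
qed

lemma AE_le_of_Lnorm_infinity:
  assumes "Lnorm \<infinity> f \<le> ennreal c" "0 \<le> c"
  shows "AE x in lborel. f x \<le> c"
proof -
  have "AE x in lborel. ennreal \<bar>f x\<bar> \<le> Lnorm \<infinity> f"
    using esssup_AE[of "\<lambda>x. ennreal \<bar>f x\<bar>" lborel] by (simp add: Lnorm_def)
  then show ?thesis
  proof (rule eventually_mono)
    fix x assume "ennreal \<bar>f x\<bar> \<le> Lnorm \<infinity> f"
    then have "ennreal \<bar>f x\<bar> \<le> ennreal c" using assms(1) by (rule order_trans)
    then show "f x \<le> c" using assms(2) by simp
  qed
qed

lemma Lnorm_infinity_le:
  assumes "f \<in> borel_measurable borel" "AE x in lborel. 0 \<le> f x" "AE x in lborel. f x \<le> c"
  shows "Lnorm \<infinity> f \<le> ennreal c"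
proof -
  note [measurable] = assms(1)
  have "AE x in lborel. ennreal \<bar>f x\<bar> \<le> ennreal c"
    using assms(2,3) by eventually_elim (simp add: ennreal_leI)
  then show ?thesis by (auto simp: Lnorm_def intro!: esssup_I)
qed

lemma borel_measurable_indicator_power:
  fixes u :: "real \<Rightarrow> 'a::euclidean_space \<Rightarrow> real"
  assumes u: "weak_dual_solution G m u0 u" and t: "0 < t1" "t1 \<le> t2"
  shows "(\<lambda>z. indicator {t1..t2} (fst z) * ennreal (u (fst z) (snd z) powr m)) \<in> borel_measurable borel"
proof -
  have [measurable]: "(\<lambda>z. indicator ({0<..<t2 + 1} \<times> UNIV) z *\<^sub>R (case z of (t, x) \<Rightarrow> u t x)) \<in> borel_measurable borel"
    using weak_dual_solutionD(5)[OF u, of "t2 + 1"] t by (simp add: set_borel_measurable_def)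
  have [measurable]: "(\<lambda>z :: real \<times> 'a. indicator {t1..t2} (fst z) :: ennreal) \<in> borel_measurable borel"
    using borel_measurable_indicator_times_fst_snd[of "\<lambda>_. 1" "{t1..t2}"] by simp
  have "(\<lambda>z. indicator {t1..t2} (fst z) *
      ennreal ((indicator ({0<..<t2 + 1} \<times> UNIV) z *\<^sub>R (case z of (t, x) \<Rightarrow> u t x)) powr m)) \<in> borel_measurable borel"
    by measurable
  also have "(\<lambda>z. indicator {t1..t2} (fst z) *
      ennreal ((indicator ({0<..<t2 + 1} \<times> UNIV) z *\<^sub>R (case z of (t, x) \<Rightarrow> u t x)) powr m))
    = (\<lambda>z. indicator {t1..t2} (fst z) * ennreal (u (fst z) (snd z) powr m))"
    using t by (auto simp: indicator_def fun_eq_iff)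
  finally show ?thesis .
qed

text \<open>The powers \<open>u(s)\<^sup>m\<close> for \<open>s\<close> between \<open>t\<^sub>1\<close> and \<open>t\<^sub>2\<close> are compared with those at the two end points
  through the monotonicity in time; its exceptional null sets depend on \<open>s\<close>, which Fubini's theorem
  takes care of.\<close>

lemma time_power_integral_bounds:
  fixes u :: "real \<Rightarrow> 'a::euclidean_space \<Rightarrow> real"
  assumes m: "1 < m" and comparison: "comparison_principle G m"
    and u0: "initial_datum u0" and u: "weak_dual_solution G m u0 u"
    and t: "0 < t1" "t1 < t2"
  shows "AE x in lborel. ennreal ((t2 - t1) * (t1 / t2) powr (m / (m - 1)) * u t1 x powr m)
      \<le> time_power_integral m u t1 t2 x"
    and "AE x in lborel. time_power_integral m u t1 t2 x
      \<le> ennreal ((t2 - t1) * (t2 / t1) powr (m / (m - 1)) * u t2 x powr m)"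
proof -
  define \<alpha> where "\<alpha> = m / (m - 1)"
  have \<alpha>: "0 < \<alpha>" using m by (auto simp: \<alpha>_def)
  have [measurable]: "u t1 \<in> borel_measurable borel" "u t2 \<in> borel_measurable borel"
    using weak_dual_solutionD(1)[OF u, of t1] weak_dual_solutionD(1)[OF u, of t2] t
    by (simp_all add: borel_measurable_integrable)
  note um = borel_measurable_indicator_power[OF u t(1) less_imp_le[OF t(2)]]
  have mono: "AE x in lborel. u s x powr m \<le> (s' / s) powr \<alpha> * u s' x powr m"
    if s: "t1 \<le> s" "s \<le> s'" for s s'
  proof -
    have pos: "0 < s" using s t by simp
    have "AE x in lborel. 0 \<le> u s x" by (rule weak_dual_solutionD(2)[OF u]) (use pos in simp)
    moreover have "AE x in lborel. u s x \<le> (s' / s) powr (1 / (m - 1)) * u s' x"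
      by (rule time_monotonicity[OF m comparison u0 u pos s(2)])
    ultimately show ?thesis
    proof eventually_elim
      case (elim x)
      then have "u s x powr m \<le> ((s' / s) powr (1 / (m - 1)) * u s' x) powr m"
        using m by (intro powr_mono2) auto
      then show ?case by (simp add: powr_mult powr_powr \<alpha>_def)
    qed
  qed
  have const: "(\<integral>\<^sup>+t. indicator {t1..t2} t * ennreal (c * f x) \<partial>lborel) = ennreal ((t2 - t1) * c * f x)"
    if "0 \<le> c" for c and f :: "'a \<Rightarrow> real" and x
    using t by (simp add: nn_integral_multc ennreal_mult'[symmetric] mult.assoc)
  have "AE x in lborel. (\<integral>\<^sup>+t. indicator {t1..t2} t * ennreal ((t1 / t2) powr \<alpha> * u t1 x powr m) \<partial>lborel)
      \<le> (\<integral>\<^sup>+t. indicator {t1..t2} t * ennreal (u t x powr m) \<partial>lborel)"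
  proof (rule nn_integral_mono_AE_swap[OF _ um])
    show "(\<lambda>z. indicator {t1..t2} (fst z) * ennreal ((t1 / t2) powr \<alpha> * u t1 (snd z) powr m)) \<in> borel_measurable borel"
      by (intro borel_measurable_indicator_times_fst_snd) auto
    show "AE t in lborel. AE x in lborel. indicator {t1..t2} t * ennreal ((t1 / t2) powr \<alpha> * u t1 x powr m)
        \<le> indicator {t1..t2} t * ennreal (u t x powr m)"
    proof (rule AE_I2)
      fix s
      show "AE x in lborel. indicator {t1..t2} s * ennreal ((t1 / t2) powr \<alpha> * u t1 x powr m)
        \<le> indicator {t1..t2} s * ennreal (u s x powr m)"
      proof (cases "s \<in> {t1..t2}")
        case True
        then have "AE x in lborel. u t1 x powr m \<le> (s / t1) powr \<alpha> * u s x powr m"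
          by (intro mono) auto
        then show ?thesis
        proof (rule eventually_mono)
          fix x assume le: "u t1 x powr m \<le> (s / t1) powr \<alpha> * u s x powr m"
          have "(s / t1) powr \<alpha> \<le> (t2 / t1) powr \<alpha>"
            using True t \<alpha> by (intro powr_mono2) (auto simp: divide_right_mono)
          then have "u t1 x powr m \<le> (t2 / t1) powr \<alpha> * u s x powr m"
            using le mult_right_mono[of "(s / t1) powr \<alpha>" "(t2 / t1) powr \<alpha>" "u s x powr m"] by simp
          then have "(t1 / t2) powr \<alpha> * u t1 x powr m \<le> (t1 / t2) powr \<alpha> * ((t2 / t1) powr \<alpha> * u s x powr m)"
            by (rule mult_left_mono) simp
          also have "\<dots> = u s x powr m"
            using t by (simp add: powr_divide)
          finally show "indicator {t1..t2} s * ennreal ((t1 / t2) powr \<alpha> * u t1 x powr m)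
            \<le> indicator {t1..t2} s * ennreal (u s x powr m)"
            by (intro mult_left_mono ennreal_leI) auto
        qed
      qed simp
    qed
  qed
  then show "AE x in lborel. ennreal ((t2 - t1) * (t1 / t2) powr (m / (m - 1)) * u t1 x powr m)
      \<le> time_power_integral m u t1 t2 x"
    unfolding time_power_integral_def \<alpha>_def[symmetric] const[of "(t1 / t2) powr \<alpha>" "\<lambda>x. u t1 x powr m", OF powr_ge_zero] .
  have "AE x in lborel. (\<integral>\<^sup>+t. indicator {t1..t2} t * ennreal (u t x powr m) \<partial>lborel)
      \<le> (\<integral>\<^sup>+t. indicator {t1..t2} t * ennreal ((t2 / t1) powr \<alpha> * u t2 x powr m) \<partial>lborel)"
  proof (rule nn_integral_mono_AE_swap[OF um])
    show "(\<lambda>z. indicator {t1..t2} (fst z) * ennreal ((t2 / t1) powr \<alpha> * u t2 (snd z) powr m)) \<in> borel_measurable borel"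
      by (intro borel_measurable_indicator_times_fst_snd) auto
    show "AE t in lborel. AE x in lborel. indicator {t1..t2} t * ennreal (u t x powr m)
        \<le> indicator {t1..t2} t * ennreal ((t2 / t1) powr \<alpha> * u t2 x powr m)"
    proof (rule AE_I2)
      fix s
      show "AE x in lborel. indicator {t1..t2} s * ennreal (u s x powr m)
        \<le> indicator {t1..t2} s * ennreal ((t2 / t1) powr \<alpha> * u t2 x powr m)"
      proof (cases "s \<in> {t1..t2}")
        case True
        then have "AE x in lborel. u s x powr m \<le> (t2 / s) powr \<alpha> * u t2 x powr m"
          by (intro mono) auto
        then show ?thesis
        proof (rule eventually_mono)
          fix x assume le: "u s x powr m \<le> (t2 / s) powr \<alpha> * u t2 x powr m"
          have "(t2 / s) powr \<alpha> \<le> (t2 / t1) powr \<alpha>"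
            using True t \<alpha> by (intro powr_mono2) (auto simp: divide_left_mono)
          then have "u s x powr m \<le> (t2 / t1) powr \<alpha> * u t2 x powr m"
            using le mult_right_mono[of "(t2 / s) powr \<alpha>" "(t2 / t1) powr \<alpha>" "u t2 x powr m"] by simp
          then show "indicator {t1..t2} s * ennreal (u s x powr m)
            \<le> indicator {t1..t2} s * ennreal ((t2 / t1) powr \<alpha> * u t2 x powr m)"
            by (intro mult_left_mono ennreal_leI) auto
        qed
      qed simp
    qed
  qed
  then show "AE x in lborel. time_power_integral m u t1 t2 x
      \<le> ennreal ((t2 - t1) * (t2 / t1) powr (m / (m - 1)) * u t2 x powr m)"
    unfolding time_power_integral_def \<alpha>_def[symmetric] const[of "(t2 / t1) powr \<alpha>" "\<lambda>x. u t2 x powr m", OF powr_ge_zero] .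
qed

lemma Lnorm_infinity_le_of_powr_le:
  fixes f :: "'a::euclidean_space \<Rightarrow> real"
  assumes f: "f \<in> borel_measurable borel" "AE x in lborel. 0 \<le> f x"
    and c: "0 < c" and m: "0 < m" and R: "0 \<le> R"
    and le: "AE x in lborel. ennreal (c * f x powr m) \<le> ennreal R"
  shows "Lnorm \<infinity> f \<le> ennreal ((R / c) powr (1 / m))"
proof (rule Lnorm_infinity_le[OF f])
  show "AE x in lborel. f x \<le> (R / c) powr (1 / m)"
    using le f(2)
  proof eventually_elim
    case (elim x)
    then have "c * f x powr m \<le> R" using R by simp
    then have "f x powr m \<le> R / c" using c by (simp add: field_simps)
    then have "(f x powr m) powr (1 / m) \<le> (R / c) powr (1 / m)"
      using m by (intro powr_mono2) auto
    then show ?case using elim m by (simp add: powr_powr)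
  qed
qed

lemma nn_integral_eq_Lnorm_1:
  assumes "AE x in lborel. 0 \<le> f x"
  shows "(\<integral>\<^sup>+x. ennreal (f x) \<partial>lborel) = Lnorm 1 f"
  unfolding Lnorm_1 using assms by (intro nn_integral_cong_AE) (auto elim: eventually_mono)

text \<open>The smoothing effect without a rate: the solution is bounded at time \<open>t\<^sub>1\<close>.\<close>

lemma finite_Lnorm_infinity:
  fixes u :: "real \<Rightarrow> 'a::euclidean_space \<Rightarrow> real" and k :: "'a \<Rightarrow> real"
    and m t1 t2 :: real
  defines "F \<equiv> time_power_integral m u t1 t2"
  assumes m: "1 < m" and comparison: "comparison_principle G m"
    and u0: "initial_datum u0" and u: "weak_dual_solution G m u0 u"
    and t: "0 < t1" "t1 < t2"
    and k [measurable]: "k \<in> borel_measurable borel"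
    and even: "\<And>z. k (- z) = k z"
    and k1: "(\<integral>\<^sup>+z. ennreal (k z) \<partial>lborel) < \<infinity>"
    and id: "AE x in lborel. F x + conv k (\<lambda>y. ennreal (u t2 y)) x = conv k F x + conv k (\<lambda>y. ennreal (u t1 y)) x"
  shows "Lnorm \<infinity> (u t1) < \<infinity>"
proof -
  have int: "integrable lborel (u t1)" "integrable lborel (u t2)"
    and pos: "AE x in lborel. 0 \<le> u t1 x" "AE x in lborel. 0 \<le> u t2 x"
    using weak_dual_solutionD(1,2)[OF u] t by auto
  have [measurable]: "u t1 \<in> borel_measurable borel" "u t2 \<in> borel_measurable borel"
    using int by (simp_all add: borel_measurable_integrable)
  have fin: "(\<integral>\<^sup>+x. ennreal (u t1 x) \<partial>lborel) < \<infinity>" "(\<integral>\<^sup>+x. ennreal (u t2 x) \<partial>lborel) < \<infinity>"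
    unfolding nn_integral_eq_Lnorm_1[OF pos(1)] nn_integral_eq_Lnorm_1[OF pos(2)] Lnorm_1
    using int by (simp_all add: integrable_iff_bounded)
  have F [measurable]: "F \<in> borel_measurable borel"
    unfolding F_def using borel_measurable_indicator_power[OF u t(1) less_imp_le[OF t(2)]]
    by (rule borel_measurable_time_power_integral)
  define \<alpha> where "\<alpha> = m / (m - 1)"
  define c1 where "c1 = (t2 - t1) * (t1 / t2) powr \<alpha>"
  have c1: "0 < c1" using t by (simp add: c1_def)
  have lower: "AE x in lborel. ennreal (c1 * u t1 x powr m) \<le> F x"
    unfolding F_def c1_def \<alpha>_def by (rule time_power_integral_bounds[OF m comparison u0 u t])
  have upper: "AE x in lborel. F x \<le> ennreal ((t2 - t1) * (t2 / t1) powr \<alpha> * u t2 x powr m)"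
    unfolding F_def \<alpha>_def by (rule time_power_integral_bounds[OF m comparison u0 u t])
  have Ffin: "(\<integral>\<^sup>+x. F x \<partial>lborel) < \<infinity>"
  proof (cases "(\<integral>\<^sup>+z. ennreal (k z) \<partial>lborel) = 0")
    case True
    \<comment> \<open>For a vanishing kernel the identity reduces to \<open>F = 0\<close>.\<close>
    have "conv k h x = 0" if "h \<in> borel_measurable borel" for h x
    proof -
      have "conv k h x \<le> conv k (\<lambda>_. top) x" by (rule conv_mono_AE) simp
      then show ?thesis using True by (simp add: conv_const)
    qed
    then have "AE x in lborel. F x = 0" using id by simp
    then show ?thesis by (simp add: nn_integral_0_iff_AE[THEN iffD2])
  next
    case False
    show ?thesis
    proof (rule integrable_of_conv_le[OF k _ F even False k1 m _ pos(2) fin(2) upper])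
      show "AE x in lborel. conv k F x \<le> F x + conv k (\<lambda>y. ennreal (u t2 y)) x"
        using id by (rule eventually_mono) simp
    qed (use t in auto)
  qed
  define d where "d = 1 + 1 / c1"
  have d: "0 < d" using c1 by (simp add: d_def add_pos_pos)
  define h where "h x = F x + ennreal (u t1 x)" for x
  have [measurable]: "h \<in> borel_measurable borel" unfolding h_def by measurable
  have hle: "AE x in lborel. h x \<le> 1 + ennreal d * conv k h x"
    using id lower pos(1)
  proof eventually_elim
    case (elim x)
    have "ennreal (u t1 x) \<le> ennreal (1 + (1 / c1) * (c1 * u t1 x powr m))"
    proof (rule ennreal_leI)
      show "u t1 x \<le> 1 + 1 / c1 * (c1 * u t1 x powr m)"
      proof (cases "u t1 x \<le> 1")
        case True
        then show ?thesis using c1 by (simp add: add_increasing2)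
      next
        case False
        then have "u t1 x powr 1 \<le> u t1 x powr m" using m by (intro powr_mono) auto
        then show ?thesis using c1 False by simp
      qed
    qed
    also have "\<dots> = 1 + ennreal (1 / c1) * ennreal (c1 * u t1 x powr m)"
      using c1 by (simp add: ennreal_mult[symmetric])
    also have "\<dots> \<le> 1 + ennreal (1 / c1) * F x"
      using elim(2) by (intro add_left_mono mult_left_mono) auto
    finally have "h x \<le> F x + (1 + ennreal (1 / c1) * F x)"
      unfolding h_def by (rule add_left_mono)
    also have "\<dots> = 1 + ennreal d * F x"
    proof -
      have "ennreal d = 1 + ennreal (1 / c1)" using c1 by (simp add: d_def)
      then show ?thesis by (simp add: distrib_left ac_simps)
    qed
    also have "\<dots> \<le> 1 + ennreal d * conv k h x"
    proof -
      have "F x \<le> F x + conv k (\<lambda>y. ennreal (u t2 y)) x" by simp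
      also have "\<dots> = conv k h x"
        unfolding h_def[abs_def] elim(1) by (rule conv_add[symmetric]) auto
      finally show ?thesis by (intro add_left_mono mult_left_mono) auto
    qed
    finally show ?case .
  qed
  have hfin: "(\<integral>\<^sup>+x. h x \<partial>lborel) < \<infinity>"
    using Ffin fin by (simp add: h_def nn_integral_add)
  obtain B where B: "0 \<le> B" "AE x in lborel. h x \<le> ennreal B"
    using bounded_of_le_conv[OF k \<open>h \<in> borel_measurable borel\<close> k1 hfin d hle] .
  have "AE x in lborel. u t1 x \<le> B"
    using B(2)
  proof (rule eventually_mono)
    fix x assume "h x \<le> ennreal B"
    then have "ennreal (u t1 x) \<le> ennreal B" unfolding h_def by (rule order_trans[rotated]) simp
    then show "u t1 x \<le> B" using B(1) by simp
  qed
  then have "Lnorm \<infinity> (u t1) \<le> ennreal B"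
    by (intro Lnorm_infinity_le pos) auto
  then show ?thesis by (rule order_le_less_trans) simp
qed

lemma smoothing_estimate_at_time:
  fixes u :: "real \<Rightarrow> 'a::euclidean_space \<Rightarrow> real" and k :: "'a \<Rightarrow> real"
    and m t1 t2 :: real
  defines "F \<equiv> time_power_integral m u t1 t2"
  assumes m: "1 < m" and p: "1 < p" and Cp: "0 < Cp" and M: "0 < M"
    and comparison: "comparison_principle G m"
    and u0: "initial_datum u0" and u: "weak_dual_solution G m u0 u"
    and mass: "\<And>t. 0 \<le> t \<Longrightarrow> Lnorm 1 (u t) \<le> ennreal M"
    and t1: "0 < t1" and t2: "m * t1 \<le> t2" "t2 \<le> (1 + m) * t1"
    and k [measurable]: "k \<in> borel_measurable borel"
    and even: "\<And>z. k (- z) = k z" and kpos: "\<And>z. 0 \<le> k z"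
    and k1: "(\<integral>\<^sup>+z. ennreal (k z) \<partial>lborel) < \<infinity>"
    and kp: "(\<integral>\<^sup>+z. ennreal (k z powr p) \<partial>lborel) \<le> ennreal (Cp powr p)"
    and id: "AE x in lborel. F x + conv k (\<lambda>y. ennreal (u t2 y)) x = conv k F x + conv k (\<lambda>y. ennreal (u t1 y)) x"
    and dec: "AE t in lborel. t1 \<le> t \<longrightarrow> Lnorm \<infinity> (u t) \<le> Lnorm \<infinity> (u t1)"
  shows "Lnorm \<infinity> (u t1) \<le> ennreal (max (((m - 1) * t1) powr (- 1 / (m - 1)))
    ((2 * (1 + m) powr (m / (m - 1)) * Cp) powr (p / (p - 1)) * M))"
proof -
  have t12: "t1 < t2"
    using mult_strict_right_mono[OF m t1] t2(1) by linarith
  have int: "integrable lborel (u t1)" and pos: "AE x in lborel. 0 \<le> u t1 x"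
    using weak_dual_solutionD(1,2)[OF u] t1 by auto
  have [measurable]: "u t1 \<in> borel_measurable borel"
    using int by (simp_all add: borel_measurable_integrable)
  note um = borel_measurable_indicator_power[OF u t1 less_imp_le[OF t12]]
  have F [measurable]: "F \<in> borel_measurable borel"
    unfolding F_def using um by (rule borel_measurable_time_power_integral)
  define c1 where "c1 = (t2 - t1) * (t1 / t2) powr (m / (m - 1))"
  have c1: "0 < c1" using t1 t12 by (simp add: c1_def)
  have lower: "AE x in lborel. ennreal (c1 * u t1 x powr m) \<le> F x"
    unfolding F_def c1_def by (rule time_power_integral_bounds[OF m comparison u0 u t1 t12])
  have "Lnorm \<infinity> (u t1) < \<infinity>"
    using finite_Lnorm_infinity[OF m comparison u0 u t1 t12 k even k1] id by (simp add: F_def)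
  then obtain U where U: "Lnorm \<infinity> (u t1) = ennreal U" "0 \<le> U"
    by (cases "Lnorm \<infinity> (u t1)") auto
  show ?thesis
  proof (cases "U = 0")
    case False
    then have U0: "0 < U" using U by simp
    have bnd: "AE t in lborel. t1 \<le> t \<longrightarrow> (AE x in lborel. 0 \<le> u t x \<and> u t x \<le> U)"
      using dec
    proof (rule eventually_mono)
      fix t assume *: "t1 \<le> t \<longrightarrow> Lnorm \<infinity> (u t) \<le> Lnorm \<infinity> (u t1)"
      show "t1 \<le> t \<longrightarrow> (AE x in lborel. 0 \<le> u t x \<and> u t x \<le> U)"
      proof
        assume t: "t1 \<le> t"
        then have "AE x in lborel. u t x \<le> U"
          using * U by (intro AE_le_of_Lnorm_infinity) auto
        moreover have "AE x in lborel. 0 \<le> u t x"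
          using t t1 by (intro weak_dual_solutionD(2)[OF u]) simp
        ultimately show "AE x in lborel. 0 \<le> u t x \<and> u t x \<le> U" by eventually_elim simp
      qed
    qed
    have Fb: "AE x in lborel. F x \<le> ennreal ((t2 - t1) * U powr m)"
    proof -
      have "AE x in lborel. (\<integral>\<^sup>+t. indicator {t1..t2} t * ennreal (u t x powr m) \<partial>lborel)
          \<le> (\<integral>\<^sup>+t. indicator {t1..t2} t * ennreal (U powr m) \<partial>lborel)"
      proof (rule nn_integral_mono_AE_swap[OF um])
        show "(\<lambda>z :: real \<times> 'a. indicator {t1..t2} (fst z) * ennreal (U powr m)) \<in> borel_measurable borel"
          using borel_measurable_indicator_times_fst_snd[of "\<lambda>_. ennreal (U powr m)" "{t1..t2}"] by simp
        show "AE t in lborel. AE x in lborel. indicator {t1..t2} t * ennreal (u t x powr m)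
            \<le> indicator {t1..t2} t * ennreal (U powr m)"
          using bnd
        proof (rule eventually_mono)
          fix t assume *: "t1 \<le> t \<longrightarrow> (AE x in lborel. 0 \<le> u t x \<and> u t x \<le> U)"
          show "AE x in lborel. indicator {t1..t2} t * ennreal (u t x powr m)
            \<le> indicator {t1..t2} t * ennreal (U powr m)"
          proof (cases "t \<in> {t1..t2}")
            case True
            then have "AE x in lborel. 0 \<le> u t x \<and> u t x \<le> U" using * by simp
            then show ?thesis
              by (rule eventually_mono) (use m in \<open>auto intro!: mult_left_mono ennreal_leI powr_mono2\<close>)
          qed simp
        qed
      qed
      then show ?thesis
        using t12 by (simp add: F_def time_power_integral_def nn_integral_multc ennreal_mult[symmetric])
    qed
    have Fa: "(\<integral>\<^sup>+x. F x \<partial>lborel) \<le> ennreal ((t2 - t1) * U powr (m - 1) * M)"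
    proof -
      have "(\<integral>\<^sup>+x. F x \<partial>lborel) = (\<integral>\<^sup>+t. \<integral>\<^sup>+x. indicator {t1..t2} t * ennreal (u t x powr m) \<partial>lborel \<partial>lborel)"
        unfolding F_def time_power_integral_def
        by (rule lborel_pair.Fubini') (use um in \<open>simp add: case_prod_unfold lborel_prod\<close>)
      also have "\<dots> \<le> (\<integral>\<^sup>+t. indicator {t1..t2} t * ennreal (U powr (m - 1) * M) \<partial>lborel)"
      proof (rule nn_integral_mono_AE)
        show "AE t in lborel. (\<integral>\<^sup>+x. indicator {t1..t2} t * ennreal (u t x powr m) \<partial>lborel)
            \<le> indicator {t1..t2} t * ennreal (U powr (m - 1) * M)"
          using bnd
        proof (rule eventually_mono)
          fix t assume *: "t1 \<le> t \<longrightarrow> (AE x in lborel. 0 \<le> u t x \<and> u t x \<le> U)"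
          show "(\<integral>\<^sup>+x. indicator {t1..t2} t * ennreal (u t x powr m) \<partial>lborel)
            \<le> indicator {t1..t2} t * ennreal (U powr (m - 1) * M)"
          proof (cases "t \<in> {t1..t2}")
            case True
            then have tt: "0 \<le> t" and b: "AE x in lborel. 0 \<le> u t x \<and> u t x \<le> U" using * t1 by auto
            have [measurable]: "u t \<in> borel_measurable borel"
              using weak_dual_solutionD(1)[OF u tt] by (simp add: borel_measurable_integrable)
            have "(\<integral>\<^sup>+x. ennreal (u t x powr m) \<partial>lborel) \<le> (\<integral>\<^sup>+x. ennreal (U powr (m - 1)) * ennreal \<bar>u t x\<bar> \<partial>lborel)"
            proof (rule nn_integral_mono_AE)
              show "AE x in lborel. ennreal (u t x powr m) \<le> ennreal (U powr (m - 1)) * ennreal \<bar>u t x\<bar>"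
                using b
              proof (rule eventually_mono)
                fix x assume x: "0 \<le> u t x \<and> u t x \<le> U"
                have "u t x powr m = u t x powr (m - 1) * u t x"
                  using x by (cases "u t x = 0") (auto simp: powr_diff)
                also have "\<dots> \<le> U powr (m - 1) * \<bar>u t x\<bar>"
                  using x m by (intro mult_mono powr_mono2) auto
                finally show "ennreal (u t x powr m) \<le> ennreal (U powr (m - 1)) * ennreal \<bar>u t x\<bar>"
                  by (simp add: ennreal_mult[symmetric] ennreal_leI)
              qed
            qed
            also have "\<dots> = ennreal (U powr (m - 1)) * Lnorm 1 (u t)"
              by (simp add: nn_integral_cmult Lnorm_1)
            also have "\<dots> \<le> ennreal (U powr (m - 1)) * ennreal M"
              by (intro mult_left_mono mass tt) simp
            finally show ?thesis using True M by (simp add: ennreal_mult)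
          qed simp
        qed
      qed
      also have "\<dots> = ennreal ((t2 - t1) * U powr (m - 1) * M)"
        using t12 M by (simp add: nn_integral_multc ennreal_mult[symmetric] mult.assoc)
      finally show ?thesis .
    qed
    have ub: "AE x in lborel. ennreal (u t1 x) \<le> ennreal U"
      using AE_le_of_Lnorm_infinity[of "u t1" U] U by (auto elim: eventually_mono intro: ennreal_leI)
    have ua: "(\<integral>\<^sup>+x. ennreal (u t1 x) \<partial>lborel) \<le> ennreal M"
      unfolding nn_integral_eq_Lnorm_1[OF pos] using t1 by (intro mass) simp
    define R where "R = Cp * ((t2 - t1) * U powr m) powr (1 / p) * ((t2 - t1) * U powr (m - 1) * M) powr (1 - 1 / p)
        + Cp * U powr (1 / p) * M powr (1 - 1 / p)"
    have R: "0 \<le> R" using Cp by (simp add: R_def)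
    have "AE x in lborel. ennreal (c1 * u t1 x powr m) \<le> ennreal R"
      using lower id
    proof eventually_elim
      case (elim x)
      have "ennreal (c1 * u t1 x powr m) \<le> F x + conv k (\<lambda>y. ennreal (u t2 y)) x"
        using elim(1) by (rule order_trans) simp
      also have "\<dots> = conv k F x + conv k (\<lambda>y. ennreal (u t1 y)) x" by (rule elim(2))
      also have "\<dots> \<le> ennreal (Cp * ((t2 - t1) * U powr m) powr (1 / p) * ((t2 - t1) * U powr (m - 1) * M) powr (1 - 1 / p))
          + ennreal (Cp * U powr (1 / p) * M powr (1 - 1 / p))"
        using t12 U0 M by (intro add_mono conv_Lp_bound k F kpos p Cp kp Fb Fa ub ua) auto
      also have "\<dots> = ennreal R"
        unfolding R_def using Cp by (intro ennreal_plus[symmetric]) auto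
      finally show ?case .
    qed
    then have "Lnorm \<infinity> (u t1) \<le> ennreal ((R / c1) powr (1 / m))"
      using m c1 R pos by (intro Lnorm_infinity_le_of_powr_le) auto
    then have "U \<le> (R / c1) powr (1 / m)" using U by simp
    then have "U powr m \<le> ((R / c1) powr (1 / m)) powr m"
      using U m by (intro powr_mono2) auto
    then have "c1 * U powr m \<le> R"
      using m c1 R by (simp add: powr_powr field_simps)
    then have "U \<le> max (((m - 1) * t1) powr (- 1 / (m - 1)))
      ((2 * (1 + m) powr (m / (m - 1)) * Cp) powr (p / (p - 1)) * M)"
      unfolding c1_def R_def by (rule smoothing_arithmetic[OF m p M Cp t1 t2 U0])
    then show ?thesis unfolding U(1) by (rule ennreal_leI)
  qed (use U in simp)
qed

lemma nn_integral_powr_le_of_Lnorm: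
  assumes p: "1 \<le> p" and C: "0 < C" and le: "Lnorm (ennreal p) f \<le> ennreal C"
  shows "(\<integral>\<^sup>+x. ennreal (\<bar>f x\<bar> powr p) \<partial>lborel) \<le> ennreal (C powr p)"
proof -
  define I where "I = (\<integral>\<^sup>+x. ennreal (\<bar>f x\<bar> powr p) \<partial>lborel)"
  have norm: "Lnorm (ennreal p) f = (if I = \<infinity> then \<infinity> else ennreal (enn2real I powr (1 / p)))"
    using p by (simp add: Lnorm_def I_def Let_def)
  with le have fin: "I \<noteq> \<infinity>" by (auto simp: top_unique)
  with norm le have "enn2real I powr (1 / p) \<le> C" using C by simp
  then have "(enn2real I powr (1 / p)) powr p \<le> C powr p"
    using p by (intro powr_mono2) auto
  then have "enn2real I \<le> C powr p" using p by (simp add: powr_powr)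
  then have "ennreal (enn2real I) \<le> ennreal (C powr p)" by (rule ennreal_leI)
  moreover have "ennreal (enn2real I) = I" using fin by (simp add: less_top)
  ultimately show ?thesis by (simp only: I_def)
qed

text \<open>The Green function is even and nonnegative up to null sets only.\<close>

lemma green_function_even_kernel:
  fixes G :: "'a::euclidean_space \<Rightarrow> 'a \<Rightarrow> real"
  assumes green: "green_function D A G"
  shows "\<exists>k\<in>borel_measurable borel. (\<forall>z. k (- z) = k z) \<and> (\<forall>z. 0 \<le> k z) \<and> (AE z in lborel. G 0 z = k z)"
proof -
  have [measurable]: "G 0 \<in> borel_measurable borel"
    using green by (simp add: green_function_def locally_integrable_def)
  have "AE z in lborel. 0 \<le> G 0 z \<and> G 0 z = G 0 (z - 0) \<and> G 0 z = G 0 (0 - z)"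
    using green unfolding green_function_def by blast
  then have "AE z in lborel. G 0 z = max 0 (max (G 0 z) (G 0 (- z)))"
    by (rule eventually_mono) auto
  then show ?thesis
    by (intro bexI[of _ "\<lambda>z. max 0 (max (G 0 z) (G 0 (- z)))"]) (auto simp: max.commute)
qed

lemma weak_dual_identity_AE:
  fixes u :: "real \<Rightarrow> 'a::euclidean_space \<Rightarrow> real"
  assumes u: "weak_dual_solution G m u0 u"
  shows "AE t1 in lborel. AE t2 in lborel. 0 < t1 \<and> t1 \<le> t2 \<longrightarrow>
    (\<forall>\<psi> \<psi>'. C1c_Linfc t1 t2 \<psi> \<psi>' \<longrightarrow> weak_dual_identity G m u t1 t2 \<psi> \<psi>')"
proof -
  have "AE \<tau> in lborel. case \<tau> of (t1, t2) \<Rightarrow> 0 < t1 \<and> t1 \<le> t2 \<and> t2 \<le> real (Suc n) \<longrightarrow>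
    (\<forall>\<psi> \<psi>'. C1c_Linfc t1 t2 \<psi> \<psi>' \<longrightarrow> weak_dual_identity G m u t1 t2 \<psi> \<psi>')" for n
  proof -
    have "weak_dual_solution_upto G m u0 (real (Suc n)) u"
      using u unfolding weak_dual_solution_def by simp
    then show ?thesis unfolding weak_dual_solution_upto_def by blast
  qed
  then have "AE \<tau> in lborel. \<forall>n. case \<tau> of (t1, t2) \<Rightarrow> 0 < t1 \<and> t1 \<le> t2 \<and> t2 \<le> real (Suc n) \<longrightarrow>
    (\<forall>\<psi> \<psi>'. C1c_Linfc t1 t2 \<psi> \<psi>' \<longrightarrow> weak_dual_identity G m u t1 t2 \<psi> \<psi>')"
    by (simp only: AE_all_countable) simp
  then have "AE \<tau> in lborel \<Otimes>\<^sub>M lborel. case \<tau> of (t1, t2) \<Rightarrow> 0 < t1 \<and> t1 \<le> t2 \<longrightarrow>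
    (\<forall>\<psi> \<psi>'. C1c_Linfc t1 t2 \<psi> \<psi>' \<longrightarrow> weak_dual_identity G m u t1 t2 \<psi> \<psi>')"
    unfolding lborel_prod
  proof (rule eventually_mono)
    fix \<tau> :: "real \<times> real"
    assume *: "\<forall>n. case \<tau> of (t1, t2) \<Rightarrow> 0 < t1 \<and> t1 \<le> t2 \<and> t2 \<le> real (Suc n) \<longrightarrow>
      (\<forall>\<psi> \<psi>'. C1c_Linfc t1 t2 \<psi> \<psi>' \<longrightarrow> weak_dual_identity G m u t1 t2 \<psi> \<psi>')"
    obtain n where "snd \<tau> \<le> real n" using real_arch_simple by blast
    then have "snd \<tau> \<le> real (Suc n)" by simp
    then show "case \<tau> of (t1, t2) \<Rightarrow> 0 < t1 \<and> t1 \<le> t2 \<longrightarrow>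
      (\<forall>\<psi> \<psi>'. C1c_Linfc t1 t2 \<psi> \<psi>' \<longrightarrow> weak_dual_identity G m u t1 t2 \<psi> \<psi>')"
      using spec[OF *, of n] by (simp add: case_prod_unfold)
  qed
  from lborel_pair.AE_pair[OF this] show ?thesis by simp
qed

text \<open>The two cases of the theorem in one bound, without the factor \<open>2\<close>.\<close>

lemma smoothing_estimate:
  fixes u :: "real \<Rightarrow> 'a::euclidean_space \<Rightarrow> real" and G :: "'a \<Rightarrow> 'a \<Rightarrow> real"
  assumes m: "1 < m" and green: "green_function D A G"
    and green_L1: "Lnorm 1 (G 0) < \<infinity>"
    and comparison: "comparison_principle G m" and decay: "Lp_decay G m"
    and u0: "initial_datum u0" and u: "weak_dual_solution G m u0 u"
    and p: "1 < p" and Cp: "0 < Cp" and green_Lp: "Lnorm (ennreal p) (G 0) \<le> ennreal Cp"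
    and M: "0 < M" "Lnorm 1 u0 \<le> ennreal M"
  shows "AE t in lborel. 0 < t \<longrightarrow> Lnorm \<infinity> (u t) \<le> ennreal (max (((m - 1) * t) powr (- 1 / (m - 1)))
    ((2 * (1 + m) powr (m / (m - 1)) * Cp) powr (p / (p - 1)) * M))"
proof -
  obtain k :: "'a \<Rightarrow> real" where k [measurable]: "k \<in> borel_measurable borel"
    and even: "\<And>z. k (- z) = k z" and kpos: "\<And>z. 0 \<le> k z" and Gk: "AE z in lborel. G 0 z = k z"
    using green_function_even_kernel[OF green] by blast
  have G [measurable]: "G 0 \<in> borel_measurable borel"
    using green by (simp add: green_function_def locally_integrable_def)
  have "(\<integral>\<^sup>+z. ennreal (k z) \<partial>lborel) = Lnorm 1 (G 0)"
    unfolding Lnorm_1 using Gk by (intro nn_integral_cong_AE) (auto elim!: eventually_mono simp: kpos)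
  then have k1: "(\<integral>\<^sup>+z. ennreal (k z) \<partial>lborel) < \<infinity>" using green_L1 by simp
  have "(\<integral>\<^sup>+z. ennreal (k z powr p) \<partial>lborel) = (\<integral>\<^sup>+z. ennreal (\<bar>G 0 z\<bar> powr p) \<partial>lborel)"
    using Gk by (intro nn_integral_cong_AE) (auto elim!: eventually_mono simp: kpos)
  also have "\<dots> \<le> ennreal (Cp powr p)"
    using p Cp green_Lp by (intro nn_integral_powr_le_of_Lnorm) auto
  finally have kp: "(\<integral>\<^sup>+z. ennreal (k z powr p) \<partial>lborel) \<le> ennreal (Cp powr p)" .
  have mass: "Lnorm 1 (u t) \<le> ennreal M" if "0 \<le> t" for t
    using mass_decay[OF decay u0 u that] M(2) by (rule order_trans)
  have dec: "AE t1 in lborel. AE t in lborel. 0 \<le> t1 \<and> t1 \<le> t \<longrightarrow> Lnorm \<infinity> (u t) \<le> Lnorm \<infinity> (u t1)"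
    by (rule Lp_decayD[OF decay u0 u]) simp
  show ?thesis
    using weak_dual_identity_AE[OF u] dec
  proof eventually_elim
    case (elim t1)
    show ?case
    proof
      assume t1: "0 < t1"
      \<comment> \<open>The time \<open>(1 + m) t\<^sub>1\<close> itself may be exceptional; a good one below it is enough.\<close>
      have "m * t1 < (1 + m) * t1" using t1 by simp
      from AE_real_obtain[OF elim(1) this] obtain t2 where t2: "m * t1 < t2" "t2 < (1 + m) * t1"
        and id: "0 < t1 \<and> t1 \<le> t2 \<longrightarrow>
          (\<forall>\<psi> \<psi>'. C1c_Linfc t1 t2 \<psi> \<psi>' \<longrightarrow> weak_dual_identity G m u t1 t2 \<psi> \<psi>')" .
      have t12: "t1 < t2" using mult_strict_right_mono[OF m t1] t2(1) by linarith
      have t20: "0 \<le> t2" "0 \<le> t1" using t12 t1 by auto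
      have identity: "AE x in lborel. time_power_integral m u t1 t2 x + conv k (\<lambda>y. ennreal (u t2 y)) x
          = conv k (time_power_integral m u t1 t2) x + conv k (\<lambda>y. ennreal (u t1 y)) x"
        using id t1 t12
        by (intro potential_identity[where G=G, OF k even kpos k1 G Gk] weak_dual_solutionD(1,2)[OF u] t20
            borel_measurable_indicator_power[OF u t1]) auto
      show "Lnorm \<infinity> (u t1) \<le> ennreal (max (((m - 1) * t1) powr (- 1 / (m - 1)))
          ((2 * (1 + m) powr (m / (m - 1)) * Cp) powr (p / (p - 1)) * M))"
      proof (rule smoothing_estimate_at_time[OF m p Cp M(1) comparison u0 u mass t1 _ _ k even kpos k1 kp identity])
        show "AE t in lborel. t1 \<le> t \<longrightarrow> Lnorm \<infinity> (u t) \<le> Lnorm \<infinity> (u t1)"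
          using elim(2) by (rule eventually_mono) (use t1 in auto)
      qed (use t2 in auto)
    qed
  qed
qed

theorem theorem3p5:
  fixes A :: "(real ^ 'n \<Rightarrow> real) \<Rightarrow> real ^ 'n \<Rightarrow> real"
    and D :: "(real ^ 'n \<Rightarrow> real) set"
    and G :: "real ^ 'n \<Rightarrow> real ^ 'n \<Rightarrow> real"
    and u0 :: "real ^ 'n \<Rightarrow> real"
    and u :: "real \<Rightarrow> real ^ 'n \<Rightarrow> real"
    and m p Cp :: real
  assumes dim: "CARD('n) \<ge> 3"
    and m: "m > 1"
    and minus_L: "admissible_operator D A"
    and green: "green_function D (id_plus A) G"
    and green_L1: "Lnorm 1 (G 0) \<le> 1"
    and comparison: "comparison_principle G m"
    and decay: "Lp_decay G m"
    and u0: "initial_datum u0"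
    and u: "weak_dual_solution G m u0 u"
    and p: "1 < p"
    and Cp: "Cp > 0"
    and green_Lp: "\<And>x0. Lnorm (ennreal p) (G x0) = Lnorm (ennreal p) (G 0)"
      "Lnorm (ennreal p) (G 0) \<le> ennreal Cp"
  shows "let q = p / (p - 1);
             C = 2 * (1 + m) powr (m / (m - 1));
             M = enn2real (Lnorm 1 u0);
             t0 = 1 / (m - 1) * (C powr q * Cp powr q) powr (- (m - 1)) * M powr (- (m - 1))
         in (AE t in lborel. 0 < t \<and> t \<le> t0 \<longrightarrow>
               Lnorm \<infinity> (u t) \<le> ennreal (2 * (m - 1) powr (- 1 / (m - 1)) * t powr (- 1 / (m - 1)))) \<and>
            (AE t in lborel. t > t0 \<longrightarrow>
               Lnorm \<infinity> (u t) \<le> ennreal (2 * C powr q * Cp powr q * M))"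
proof -
  define q where "q = p / (p - 1)"
  define C where "C = 2 * (1 + m) powr (m / (m - 1))"
  define M where "M = enn2real (Lnorm 1 u0)"
  define K where "K = C powr q * Cp powr q * M"
  define t0 where "t0 = 1 / (m - 1) * (C powr q * Cp powr q) powr (- (m - 1)) * M powr (- (m - 1))"
  have t0K: "t0 = K powr (- (m - 1)) / (m - 1)"
    by (simp only: t0_def K_def powr_mult) simp
  have t0: "0 \<le> t0" using m by (simp add: t0K)
  have C: "0 < C" using m by (simp add: C_def)
  have "Lnorm 1 u0 < \<infinity>"
    using u0 by (simp add: Lnorm_1 initial_datum_def integrable_iff_bounded)
  then have M: "Lnorm 1 u0 = ennreal M" "0 \<le> M" by (simp_all add: M_def less_top)
  have early: "2 * (m - 1) powr (- 1 / (m - 1)) * t powr (- 1 / (m - 1)) = 2 * ((m - 1) * t) powr (- 1 / (m - 1))"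
    for t by (simp add: powr_mult)
  have "(AE t in lborel. 0 < t \<and> t \<le> t0 \<longrightarrow>
           Lnorm \<infinity> (u t) \<le> ennreal (2 * ((m - 1) * t) powr (- 1 / (m - 1)))) \<and>
        (AE t in lborel. t > t0 \<longrightarrow> Lnorm \<infinity> (u t) \<le> ennreal (2 * K))"
  proof (cases "M = 0")
    case True
    \<comment> \<open>Here \<open>t0 = 0\<close>, because \<open>0\<close> to any power is \<open>0\<close>, and the solution vanishes.\<close>
    have "Lnorm \<infinity> (u t) \<le> ennreal 0" if t: "0 \<le> t" for t
    proof (rule Lnorm_infinity_le)
      have int: "integrable lborel (u t)" by (rule weak_dual_solutionD(1)[OF u t])
      then show meas: "u t \<in> borel_measurable borel" by (simp add: borel_measurable_integrable)
      show "AE x in lborel. 0 \<le> u t x" by (rule weak_dual_solutionD(2)[OF u t])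
      have "Lnorm 1 (u t) = 0"
        using mass_decay[OF decay u0 u t] M True by simp
      then have "AE x in lborel. ennreal \<bar>u t x\<bar> = 0"
        using meas by (simp add: Lnorm_1 nn_integral_0_iff_AE)
      then show "AE x in lborel. u t x \<le> 0"
        by (rule eventually_mono) (simp add: ennreal_eq_0_iff)
    qed
    then show ?thesis
      using t0 True by (intro conjI AE_I2) (auto simp: t0K K_def)
  next
    case False
    then have M0: "0 < M" using M by simp
    have K: "0 < K" using C Cp M0 by (simp add: K_def)
    have est: "AE t in lborel. 0 < t \<longrightarrow> Lnorm \<infinity> (u t) \<le> ennreal (max (((m - 1) * t) powr (- 1 / (m - 1))) K)"
    proof -
      have "Lnorm 1 (G 0) < \<infinity>" using green_L1 by (rule order_le_less_trans) simp
      moreover have "Lnorm 1 u0 \<le> ennreal M" using M(1) by simp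
      moreover have "(C * Cp) powr q * M = K" by (simp only: K_def powr_mult)
      ultimately show ?thesis
        using smoothing_estimate[OF m green _ comparison decay u0 u p Cp green_Lp(2) M0]
        unfolding C_def[symmetric] q_def[symmetric] by (simp only: simp_thms)
    qed
    have t0': "((m - 1) * t0) powr (- 1 / (m - 1)) = K"
    proof -
      have "- (m - 1) * (- 1 / (m - 1)) = 1" using m by (simp add: field_simps)
      moreover have "(m - 1) * t0 = K powr (- (m - 1))" using m by (simp add: t0K)
      ultimately show ?thesis using K by (simp only: powr_powr powr_one less_imp_le)
    qed
    have t00: "0 < t0" using m K by (simp add: t0K)
    have anti: "((m - 1) * t) powr (- 1 / (m - 1)) \<le> ((m - 1) * s) powr (- 1 / (m - 1))"
      if "0 < s" "s \<le> t" for s t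
      using that m by (intro powr_mono2') (auto simp: divide_nonpos_pos)
    show ?thesis
    proof
      show "AE t in lborel. 0 < t \<and> t \<le> t0 \<longrightarrow> Lnorm \<infinity> (u t) \<le> ennreal (2 * ((m - 1) * t) powr (- 1 / (m - 1)))"
        using est
      proof (rule eventually_mono, intro impI)
        fix t assume le: "0 < t \<longrightarrow> Lnorm \<infinity> (u t) \<le> ennreal (max (((m - 1) * t) powr (- 1 / (m - 1))) K)"
          and t: "0 < t \<and> t \<le> t0"
        have "K \<le> ((m - 1) * t) powr (- 1 / (m - 1))"
          using anti[of t t0] t t0' by simp
        then have "max (((m - 1) * t) powr (- 1 / (m - 1))) K \<le> 2 * ((m - 1) * t) powr (- 1 / (m - 1))"
          using K by simp
        then show "Lnorm \<infinity> (u t) \<le> ennreal (2 * ((m - 1) * t) powr (- 1 / (m - 1)))"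
          using le t by (meson ennreal_leI order_trans)
      qed
      show "AE t in lborel. t > t0 \<longrightarrow> Lnorm \<infinity> (u t) \<le> ennreal (2 * K)"
        using est
      proof (rule eventually_mono, intro impI)
        fix t assume le: "0 < t \<longrightarrow> Lnorm \<infinity> (u t) \<le> ennreal (max (((m - 1) * t) powr (- 1 / (m - 1))) K)"
          and t: "t0 < t"
        have "((m - 1) * t) powr (- 1 / (m - 1)) \<le> K"
          using anti[of t0 t] t t0' t00 by simp
        then have "max (((m - 1) * t) powr (- 1 / (m - 1))) K \<le> 2 * K"
          using K by simp
        then show "Lnorm \<infinity> (u t) \<le> ennreal (2 * K)"
          using le t t00 by (meson ennreal_leI order_trans less_trans)
      qed
    qed
  qed
  then show ?thesis
    unfolding Let_def q_def[symmetric] C_def[symmetric] M_def[symmetric] t0_def[symmetric] early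
    by (simp add: K_def mult.assoc)
qed

end
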